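(* Let $N \geq 3$ and $M \geq 2$, let $y_1,\ldots,y_M \in \mathbb{H}^N$ be distinct points, and let $d := \min_{1\le j\neq k\le M} \frac{\mathrm{d}(y_j,y_k)}{2} > 0$. Let $\bar d = \bar d(M,N) > 0$ be defined implicitly by $$\frac{\pi^2}{\bar d^2} + (M+1)\left(\frac{(N-2)^2}{4}\frac{1}{\bar d^2} + \frac{(N-3)(N-2)}{2}\, g(\bar d/2)\right) = N-2.$$ If $d \geq \bar d$, then for all $u \in C_c^\infty(\mathbb{H}^N)$, $$\int_{\mathbb{H}^N} |\nabla_{\mathbb{H}^N} u|^2 \, dv_{\mathbb{H}^N} \geq \frac{(N-2)^2}{4}\sum_{k=1}^M \int_{\mathbb{H}^N} \frac{u^2}{\mathrm{d}^2(x,y_k)}\, dv_{\mathbb{H}^N} + \frac{(N-2)(N-3)}{2}\sum_{k=1}^M \int_{\mathbb{H}^N} g(\mathrm{d}(x,y_k))\, u^2 \, dv_{\mathbb{H}^N}.$$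
   Context: $\mathbb{H}^N$ is the $N$-dimensional hyperbolic space (constant sectional curvature $-1$), with geodesic distance $\mathrm{d}(\cdot,\cdot)$, Riemannian gradient $\nabla_{\mathbb{H}^N}$ and Riemannian volume $dv_{\mathbb{H}^N}$; functions $u$ are real valued. The function $g$ is $g(r) := \frac{r\coth r - 1}{r^2}$ for $r>0$; it is positive and strictly decreasing, with $g(r)\sim \frac13$ as $r\to0^+$ and $g(r)\sim\frac1r$ as $r\to+\infty$. *)

theory Defs
  imports "HOL-Analysis.Analysis" "HOL-Real_Asymp.Real_Asymp"
begin

text \<open>
  Hyperbolic space of dimension \<open>CARD('n)\<close> and constant curvature \<open>-1\<close>, in the Poincare
  ball model: the open unit ball with the metric \<open>4 |dx|^2 / (1 - |x|^2)^2\<close>.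
\<close>

definition hyp_space :: "(real ^ 'n) set" where
  "hyp_space = ball 0 1"

definition hyp_metric :: "real ^ 'n \<Rightarrow> real ^ 'n \<Rightarrow> real ^ 'n \<Rightarrow> real" where
  "hyp_metric x v w = 4 / (1 - (norm x)\<^sup>2)\<^sup>2 * (v \<bullet> w)"

definition hyp_norm :: "real ^ 'n \<Rightarrow> real ^ 'n \<Rightarrow> real" where
  "hyp_norm x v = sqrt (hyp_metric x v v)"

definition hyp_length :: "(real \<Rightarrow> real ^ 'n) \<Rightarrow> real" where
  "hyp_length \<gamma> = integral {0..1} (\<lambda>t. hyp_norm (\<gamma> t) (vector_derivative \<gamma> (at t)))"

text \<open>
  The curves are \<open>C\<^sup>1\<close> on the closed interval. The library's piecewise \<open>C\<^sup>1\<close> curves would not do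
  here: their derivative may blow up at the exceptional points, and a curve of infinite length
  would then contribute the default value \<open>0\<close> of the integral.
\<close>

definition hyp_dist :: "real ^ 'n \<Rightarrow> real ^ 'n \<Rightarrow> real" where
  "hyp_dist x y = (INF \<gamma> \<in> {\<gamma>. \<gamma> C1_differentiable_on {0..1} \<and> path_image \<gamma> \<subseteq> hyp_space \<and>
      pathstart \<gamma> = x \<and> pathfinish \<gamma> = y}. hyp_length \<gamma>)"

definition hyp_grad :: "(real ^ 'n \<Rightarrow> real) \<Rightarrow> real ^ 'n \<Rightarrow> real ^ 'n" where
  "hyp_grad u x = (THE w. \<forall>v. hyp_metric x w v = frechet_derivative u (at x) v)"

text \<open>
  The density is the square root of the determinant of the Gram matrix
  \<open>4 / (1 - |x|^2)^2 \<cdot> I\<close> of the metric.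
\<close>

definition hyp_vol :: "(real ^ 'n) measure" where
  "hyp_vol = density (restrict_space lborel hyp_space)
     (\<lambda>x. ennreal ((2 / (1 - (norm x)\<^sup>2)) ^ CARD('n)))"

text \<open>For open \<open>S\<close>, \<open>Ck_on k f S\<close> says that \<open>f\<close> is \<open>k\<close> times continuously differentiable on \<open>S\<close>.\<close>

primrec Ck_on :: "nat \<Rightarrow> ('a::real_normed_vector \<Rightarrow> real) \<Rightarrow> 'a set \<Rightarrow> bool" where
  "Ck_on 0 f S \<longleftrightarrow> continuous_on S f"
| "Ck_on (Suc k) f S \<longleftrightarrow> (\<forall>x\<in>S. f differentiable (at x)) \<and>
     (\<forall>v. Ck_on k (\<lambda>x. frechet_derivative f (at x) v) S)"

text \<open>
  Functions on hyperbolic space are represented by functions on the whole of \<open>real ^ 'n\<close>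
  whose values outside the ball are irrelevant.
\<close>

definition hyp_test_function :: "(real ^ 'n \<Rightarrow> real) \<Rightarrow> bool" where
  "hyp_test_function u \<longleftrightarrow> (\<forall>k. Ck_on k u hyp_space) \<and>
     (\<exists>K. compact K \<and> K \<subseteq> hyp_space \<and> (\<forall>x \<in> hyp_space - K. u x = 0))"

definition hardy_g :: "real \<Rightarrow> real" where
  "hardy_g r = (r * (cosh r / sinh r) - 1) / r\<^sup>2"

definition dbar_eq :: "nat \<Rightarrow> nat \<Rightarrow> real \<Rightarrow> bool" where
  "dbar_eq M N \<delta> \<longleftrightarrow>
     pi\<^sup>2 / \<delta>\<^sup>2 + (real M + 1) * ((real N - 2)\<^sup>2 / 4 * (1 / \<delta>\<^sup>2)
        + (real N - 3) * (real N - 2) / 2 * hardy_g (\<delta> / 2)) = real N - 2"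

definition dbar :: "nat \<Rightarrow> nat \<Rightarrow> real" where
  "dbar M N = (THE \<delta>. \<delta> > 0 \<and> dbar_eq M N \<delta>)"

lemma hardy_g_antimono:
  assumes "0 < r" "r \<le> s"
  shows "hardy_g s \<le> hardy_g r"
proof -
  have h3: "s * cosh s - sinh s \<ge> 0" if "s \<ge> 0" for s :: real
  proof -
    have "0 * cosh 0 - sinh 0 \<le> s * cosh s - sinh s"
      by (rule DERIV_nonneg_imp_nondecreasing[OF that], rule exI, rule conjI,
          (rule derivative_eq_intros refl | simp)+)
    then show ?thesis by simp
  qed
  have h2: "1/2 - cosh s / 2 + s * sinh s / 4 \<ge> 0" if "s \<ge> 0" for s :: real
  proof -
    have "1/2 - cosh 0 / 2 + 0 * sinh 0 / 4 \<le> 1/2 - cosh s / 2 + s * sinh s / 4"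
    proof (rule DERIV_nonneg_imp_nondecreasing[OF that])
      fix x :: real assume "0 \<le> x"
      have "((\<lambda>s. 1/2 - cosh s / 2 + s * sinh s / 4) has_real_derivative (x * cosh x - sinh x) / 4) (at x)"
        by (auto intro!: derivative_eq_intros simp: field_simps)
      then show "\<exists>y. ((\<lambda>s. 1/2 - cosh s / 2 + s * sinh s / 4) has_real_derivative y) (at x) \<and> 0 \<le> y"
        using h3[OF \<open>0 \<le> x\<close>] by (intro exI conjI) auto
    qed
    then show ?thesis by simp
  qed
  have h1: "s/2 - 3/4 * sinh s + s * cosh s / 4 \<ge> 0" if "s \<ge> 0" for s :: real
  proof -
    have "0/2 - 3/4 * sinh 0 + 0 * cosh 0 / 4 \<le> s/2 - 3/4 * sinh s + s * cosh s / 4"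
    proof (rule DERIV_nonneg_imp_nondecreasing[OF that])
      fix x :: real assume "0 \<le> x"
      have "((\<lambda>s. s/2 - 3/4 * sinh s + s * cosh s / 4) has_real_derivative
          1/2 - cosh x / 2 + x * sinh x / 4) (at x)"
        by (auto intro!: derivative_eq_intros simp: field_simps)
      then show "\<exists>y. ((\<lambda>s. s/2 - 3/4 * sinh s + s * cosh s / 4) has_real_derivative y) (at x) \<and> 0 \<le> y"
        using h2[OF \<open>0 \<le> x\<close>] by blast
    qed
    then show ?thesis by simp
  qed
  have h0: "s\<^sup>2/4 + s * sinh s / 4 - cosh s + 1 \<ge> 0" if "s \<ge> 0" for s :: real
  proof -
    have "0\<^sup>2/4 + 0 * sinh 0 / 4 - cosh 0 + 1 \<le> s\<^sup>2/4 + s * sinh s / 4 - cosh s + 1"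
    proof (rule DERIV_nonneg_imp_nondecreasing[OF that])
      fix x :: real assume "0 \<le> x"
      have "((\<lambda>s. s\<^sup>2/4 + s * sinh s / 4 - cosh s + 1) has_real_derivative
          x/2 - 3/4 * sinh x + x * cosh x / 4) (at x)"
        by (auto intro!: derivative_eq_intros simp: field_simps)
      then show "\<exists>y. ((\<lambda>s. s\<^sup>2/4 + s * sinh s / 4 - cosh s + 1) has_real_derivative y) (at x) \<and> 0 \<le> y"
        using h1[OF \<open>0 \<le> x\<close>] by blast
    qed
    then show ?thesis by simp
  qed
  have h: "2 * (sinh x)\<^sup>2 \<le> x\<^sup>2 + x * sinh x * cosh x" if "x \<ge> 0" for x :: real
    using h0[of "2 * x"] that cosh_square_eq[of x] unfolding cosh_double sinh_double
    by (simp add: power2_eq_square field_simps)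
  show ?thesis
  proof (rule DERIV_nonpos_imp_nonincreasing[OF assms(2)])
    fix x assume "r \<le> x"
    then have x: "x > 0" "sinh x > 0" using assms by auto
    have "(hardy_g has_real_derivative (2 * (sinh x)\<^sup>2 - x\<^sup>2 - x * sinh x * cosh x) / (x^3 * (sinh x)\<^sup>2)) (at x)"
    proof -
      have e: "(sinh x * sinh x - cosh x * cosh x) = -1"
        using cosh_square_eq[of x] by (simp add: power2_eq_square)
      have "((\<lambda>r. (r * (cosh r / sinh r) - 1) / r\<^sup>2) has_real_derivative
         (((cosh x / sinh x) + (sinh x * sinh x - cosh x * cosh x) / (sinh x * sinh x) * x) * x\<^sup>2
           - (x * (cosh x / sinh x) - 1) * (2 * x)) / (x\<^sup>2 * x\<^sup>2)) (at x)"
        using x by (auto intro!: derivative_eq_intros) (simp add: field_simps)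
      moreover have "(((cosh x / sinh x) + (sinh x * sinh x - cosh x * cosh x) / (sinh x * sinh x) * x) * x\<^sup>2
           - (x * (cosh x / sinh x) - 1) * (2 * x)) / (x\<^sup>2 * x\<^sup>2)
         = (2 * (sinh x)\<^sup>2 - x\<^sup>2 - x * sinh x * cosh x) / (x^3 * (sinh x)\<^sup>2)"
        unfolding e using x by (simp add: field_simps power2_eq_square power3_eq_cube)
      ultimately show ?thesis unfolding hardy_g_def[abs_def] by simp
    qed
    moreover have "(2 * (sinh x)\<^sup>2 - x\<^sup>2 - x * sinh x * cosh x) / (x^3 * (sinh x)\<^sup>2) \<le> 0"
      using h[of x] x by (intro divide_nonpos_nonneg) auto
    ultimately show "\<exists>y. (hardy_g has_real_derivative y) (at x) \<and> y \<le> 0" by blast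
  qed
qed

lemma dbar_ex1:
  assumes "N \<ge> 3"
  shows "\<exists>!\<delta>. \<delta> > 0 \<and> dbar_eq M N \<delta>"
proof -
  define F where "F = (\<lambda>\<delta>. pi\<^sup>2 / \<delta>\<^sup>2 + (real M + 1) * ((real N - 2)\<^sup>2 / 4 * (1 / \<delta>\<^sup>2)
        + (real N - 3) * (real N - 2) / 2 * hardy_g (\<delta> / 2)))"
  have N: "real N \<ge> 3" using assms by simp
  have strict: "F t < F s" if "0 < s" "s < t" for s t
  proof -
    have i: "1 / t\<^sup>2 < 1 / s\<^sup>2"
      using that by (intro divide_strict_left_mono power_strict_mono) auto
    have a: "pi\<^sup>2 / t\<^sup>2 < pi\<^sup>2 / s\<^sup>2"
      using that by (intro divide_strict_left_mono power_strict_mono) auto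
    have b: "(real N - 2)\<^sup>2 / 4 * (1 / t\<^sup>2) \<le> (real N - 2)\<^sup>2 / 4 * (1 / s\<^sup>2)"
      using i by (intro mult_left_mono) auto
    have c: "(real N - 3) * (real N - 2) / 2 * hardy_g (t / 2) \<le> (real N - 3) * (real N - 2) / 2 * hardy_g (s / 2)"
      using hardy_g_antimono[of "s/2" "t/2"] that N by (intro mult_left_mono) auto
    show ?thesis unfolding F_def
      by (intro add_less_le_mono a mult_left_mono add_mono b c) auto
  qed
  have lim0: "filterlim F at_top (at_right 0)"
  proof -
    have g0: "((\<lambda>\<delta>. hardy_g (\<delta> / 2)) \<longlongrightarrow> 1/3) (at_right 0)"
      unfolding hardy_g_def sinh_field_def cosh_field_def
      by (real_asymp simp: power2_eq_square)
    have "((\<lambda>\<delta>. (real M + 1) * ((real N - 3) * (real N - 2) / 2 * hardy_g (\<delta> / 2)))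
        \<longlongrightarrow> (real M + 1) * ((real N - 3) * (real N - 2) / 2 * (1/3))) (at_right 0)"
      by (intro tendsto_intros g0)
    moreover have "filterlim (\<lambda>\<delta>. (pi\<^sup>2 + (real M + 1) * ((real N - 2)\<^sup>2 / 4)) * (1 / \<delta>\<^sup>2)) at_top (at_right 0)"
    proof (rule filterlim_tendsto_pos_mult_at_top[OF tendsto_const])
      show "0 < pi\<^sup>2 + (real M + 1) * ((real N - 2)\<^sup>2 / 4)"
        by (intro add_pos_nonneg) auto
      show "filterlim (\<lambda>\<delta>::real. 1 / \<delta>\<^sup>2) at_top (at_right 0)" by real_asymp
    qed
    ultimately have "filterlim (\<lambda>\<delta>. (real M + 1) * ((real N - 3) * (real N - 2) / 2 * hardy_g (\<delta> / 2)) +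
        (pi\<^sup>2 + (real M + 1) * ((real N - 2)\<^sup>2 / 4)) * (1 / \<delta>\<^sup>2)) at_top (at_right 0)"
      by (rule filterlim_tendsto_add_at_top)
    then show ?thesis unfolding F_def by (simp add: algebra_simps add_divide_distrib)
  qed
  have liminf: "(F \<longlongrightarrow> 0) at_top"
  proof -
    have g0: "((\<lambda>\<delta>. hardy_g (\<delta> / 2)) \<longlongrightarrow> 0) at_top"
      unfolding hardy_g_def sinh_field_def cosh_field_def by real_asymp
    have i: "((\<lambda>\<delta>::real. 1 / \<delta>\<^sup>2) \<longlongrightarrow> 0) at_top" by real_asymp
    have p: "((\<lambda>\<delta>::real. pi\<^sup>2 / \<delta>\<^sup>2) \<longlongrightarrow> 0) at_top"
      using tendsto_mult[OF tendsto_const[of "pi\<^sup>2"] i] by simp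
    have "(F \<longlongrightarrow> 0 + (real M + 1) * ((real N - 2)\<^sup>2 / 4 * 0 + (real N - 3) * (real N - 2) / 2 * 0)) at_top"
      unfolding F_def by (intro tendsto_intros g0 i p)
    then show ?thesis by simp
  qed
  obtain b where b: "b > 0" "F b \<le> real N - 2"
  proof -
    have "eventually (\<lambda>\<delta>. F \<delta> < real N - 2) at_top"
      using order_tendstoD(2)[OF liminf, of "real N - 2"] N by simp
    then have "eventually (\<lambda>\<delta>. \<delta> > 0 \<and> F \<delta> < real N - 2) at_top"
      using eventually_gt_at_top[of 0] by eventually_elim auto
    then obtain b where "b > 0 \<and> F b < real N - 2"
      using eventually_happens'[of "at_top :: real filter"] by auto
    then show ?thesis using that by auto
  qed
  obtain a where a: "a > 0" "a \<le> b" "F a \<ge> real N - 2"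
  proof -
    have "eventually (\<lambda>\<delta>. F \<delta> \<ge> real N - 2) (at_right 0)"
      using lim0 unfolding filterlim_at_top by blast
    moreover have "eventually (\<lambda>\<delta>. \<delta> \<in> {0<..<b}) (at_right 0)"
      using b(1) by (rule eventually_at_right_real)
    ultimately have "eventually (\<lambda>\<delta>. \<delta> \<in> {0<..<b} \<and> F \<delta> \<ge> real N - 2) (at_right 0)"
      by eventually_elim auto
    then obtain a where "a \<in> {0<..<b} \<and> F a \<ge> real N - 2"
      using eventually_happens'[of "at_right (0::real)"] by auto
    then show ?thesis using that by auto
  qed
  have "continuous_on {a..b} F"
    unfolding F_def hardy_g_def using a(1) by (intro continuous_intros) auto
  then obtain x where "a \<le> x" "x \<le> b" "F x = real N - 2"
    using IVT2'[of F b "real N - 2" a] a b by auto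
  then have x: "x > 0" "F x = real N - 2" using a by auto
  have eq: "dbar_eq M N \<delta> \<longleftrightarrow> F \<delta> = real N - 2" for \<delta>
    by (simp add: dbar_eq_def F_def)
  show ?thesis unfolding eq
  proof (rule ex1I[of _ x])
    fix t assume "t > 0 \<and> F t = real N - 2"
    then show "t = x" using strict[of t x] strict[of x t] x
      by (cases t x rule: linorder_cases) auto
  qed (use x in auto)
qed

end

theory Submission
  imports Defs
begin

text \<open>
  The inequality is proved by a vector field argument. For a vector field \<open>X\<close>, the square
  \<open>|\<nabla>u + u X|\<^sup>2 \<ge> 0\<close> and the divergence theorem give
  \<open>\<integral>|\<nabla>u|\<^sup>2 \<ge> \<integral>(div X - |X|\<^sup>2) u\<^sup>2\<close>, so that it suffices to find a field \<open>X\<close> with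
  \<open>div X - |X|\<^sup>2 \<ge> W\<close>, where \<open>W\<close> is the sum over the poles \<open>y\<^sub>k\<close> of
  \<open>V(r\<^sub>k) = (N-2)\<^sup>2/4 / r\<^sub>k\<^sup>2 + (N-2)(N-3)/2 g(r\<^sub>k)\<close> and \<open>r\<^sub>k\<close> is the distance from \<open>y\<^sub>k\<close>.

  One pole. The function \<open>\<phi>(r) = r\<^bsup>(N-2)/2\<^esup> (sinh r)\<^bsup>-(N-2)\<^esup>\<close> satisfies
  \<open>-\<Delta>\<phi> = (V(r) + N - 2) \<phi>\<close>, so \<open>X = -\<nabla>\<phi>/\<phi>\<close> satisfies \<open>div X - |X|\<^sup>2 = V + N - 2\<close>
  (lemma \<open>pole_slope_riccati\<close>). The additional spectral term \<open>N - 2\<close> pays for the passage to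
  several poles. Far from all poles the supersolution \<open>1 / cosh\<close> of the distance from the centre
  of the ball gives a smooth field \<open>X\<^sub>0\<close> with \<open>div X\<^sub>0 - |X\<^sub>0|\<^sup>2 \<ge> N - 2\<close>.

  Several poles. The balls of radius \<open>d\<close> about the poles are disjoint, by the triangle inequality.
  Let \<open>m\<^sub>k\<close> be \<open>1\<close> where \<open>r\<^sub>k \<le> d/2\<close>, \<open>0\<close> where \<open>r\<^sub>k \<ge> d\<close>, and
  \<open>sin\<^sup>2(\<pi> r\<^sub>k / d)\<close> in between, and take
  \<open>X = (\<Sum>\<^sub>k m\<^sub>k X\<^sub>k) + (1 - \<Sum>\<^sub>k m\<^sub>k) X\<^sub>0\<close>. As in the IMS localization formula for
  \<open>sin\<^sup>2 + cos\<^sup>2 = 1\<close>, the gluing costs at most \<open>\<pi>\<^sup>2 / d\<^sup>2\<close>, and only on the annuli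
  (lemma \<open>localized_field_ineq\<close>). What remains is the scalar inequality
  \<open>hardy_potential_sum_le\<close>: the part of \<open>W\<close> that is not produced by the field at a given
  point is at most \<open>M + 1\<close> times the bracket in the equation that defines the threshold distance,
  and that equation says that the constant \<open>N - 2\<close> compensates it together with the gluing cost.

  Singularities. The field \<open>X\<^sub>k\<close> points away from \<open>y\<^sub>k\<close>. Multiplying it by a
  radially increasing function \<open>h\<close> that vanishes near \<open>y\<^sub>k\<close> therefore turns the divergence
  into \<open>h div X\<^sub>k\<close> plus a nonnegative term, and the inequality holds with \<open>W\<close> replaced by \<open>0\<close> near the poles, without error
  term (lemma \<open>cut_slope_riccati\<close>). Monotone convergence restores \<open>W\<close>.

  The computations take place in the Poincare ball. Everything is expressed by the function
  \<open>c\<^sub>y(x) = cosh(d(x, y))\<close>, a rational function of \<open>x\<close> that is smooth also at \<open>y\<close>. In terms of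
  the Euclidean inner product and the conformal factor \<open>q = 2 / (1 - |x|\<^sup>2)\<close> it satisfies
  \<open>|\<nabla>c|\<^sup>2 = q\<^sup>2 (c\<^sup>2 - 1)\<close> and \<open>div (q\<^bsup>N-2\<^esup> \<nabla>c) = N q\<^sup>N c\<close>
  (lemmas \<open>grad_cosh_dist_sq\<close> and \<open>divergence_weighted_grad\<close>). That \<open>c\<^sub>y\<close> is indeed the
  hyperbolic cosine of the distance, which is defined as an infimum of lengths, is
  \<open>hyp_dist_eq_arcosh\<close>.
\<close>

section \<open>Integrals of divergences\<close>

text \<open>
  The integral of the difference quotient \<open>(f(x + h v) - f(x)) / h\<close> vanishes for every \<open>h\<close>
  because Lebesgue measure is translation invariant; dominated convergence carries this over to
  the limit \<open>h \<rightarrow> 0\<close>.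
\<close>

lemma integral_directional_derivative_eq_0:
  fixes f :: "'a::euclidean_space \<Rightarrow> real"
  assumes K: "compact K" and out: "\<And>x. x \<notin> K \<Longrightarrow> f x = 0"
    and der: "\<And>x. ((\<lambda>t. f (x + t *\<^sub>R v)) has_real_derivative f' x) (at 0)"
    and cf: "continuous_on UNIV f" and cf': "continuous_on UNIV f'"
  shows "integrable lborel f'" "(LINT x|lborel. f' x) = 0"
proof -
  have der': "((\<lambda>t. f (x + t *\<^sub>R v)) has_real_derivative f' (x + s *\<^sub>R v)) (at s)" for x s
  proof -
    have "((\<lambda>t. f ((x + s *\<^sub>R v) + t *\<^sub>R v)) has_real_derivative f' (x + s *\<^sub>R v)) (at 0)"
      by (rule der)
    then have "((\<lambda>t. f (x + (t + s) *\<^sub>R v)) has_real_derivative f' (x + s *\<^sub>R v)) (at 0)"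
      by (simp add: algebra_simps)
    then have "((\<lambda>t. f (x + t *\<^sub>R v)) has_real_derivative f' (x + s *\<^sub>R v)) (at (0 + s))"
      unfolding DERIV_shift by simp
    then show ?thesis by simp
  qed
  have f'0: "f' x = 0" if "x \<notin> K" for x
  proof -
    have "open (- K)" using K by (simp add: compact_imp_closed open_Compl)
    moreover have "((\<lambda>t. x + t *\<^sub>R v) \<longlongrightarrow> x) (at 0)"
      by (auto intro!: tendsto_eq_intros)
    ultimately have "eventually (\<lambda>t. x + t *\<^sub>R v \<in> - K) (at 0)"
      using that by (intro topological_tendstoD) auto
    then have "eventually (\<lambda>t. f (x + t *\<^sub>R v) = 0) (at 0)"
      by eventually_elim (use out in auto)
    moreover have "f (x + 0 *\<^sub>R v) = 0" using out that by simp
    ultimately have "((\<lambda>t. 0::real) has_real_derivative f' x) (at 0)"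
      using der[of x] by (subst (asm) DERIV_cong_ev[OF refl _ refl]) (auto simp: eventually_nhds_conv_at)
    then show ?thesis using DERIV_unique DERIV_const by blast
  qed
  obtain B where B: "\<And>x. \<bar>f' x\<bar> \<le> B" "B \<ge> 0"
  proof -
    have "compact (f' ` K)"
      by (rule compact_continuous_image[OF continuous_on_subset[OF cf'] K]) simp
    then obtain B where "\<forall>y\<in>f' ` K. norm y \<le> B" using compact_imp_bounded bounded_iff by blast
    then have "\<bar>f' x\<bar> \<le> max B 0" for x using f'0[of x] by (cases "x \<in> K") fastforce+
    then show ?thesis using that[of "max B 0"] by auto
  qed
  obtain R where R: "\<And>x. x \<in> K \<Longrightarrow> norm x \<le> R"
    using compact_imp_bounded[OF K] bounded_iff by blast
  define R' where "R' = R + norm v"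
  \<comment> \<open>Steps at most \<open>1\<close> keep the supports of all difference quotients in one ball.\<close>
  define h where "h = (\<lambda>n::nat. 1 / (real n + 1))"
  have h: "0 < h n" "h n \<le> 1" for n by (auto simp: h_def)
  define s where "s = (\<lambda>n x. (f (x + h n *\<^sub>R v) - f x) / h n)"
  have meas_f: "f \<in> borel_measurable borel" using cf by (rule borel_measurable_continuous_onI)
  have meas_f': "f' \<in> borel_measurable borel" using cf' by (rule borel_measurable_continuous_onI)
  have meas_s: "s n \<in> borel_measurable borel" for n
    unfolding s_def using h(1)[of n] by (intro borel_measurable_continuous_onI continuous_intros
      continuous_on_compose2[OF cf]) auto
  have intf: "integrable lborel f"
  proof -
    have "integrable lborel (\<lambda>x. indicator K x *\<^sub>R f x)"
      by (rule borel_integrable_compact[OF K]) (rule continuous_on_subset[OF cf], simp)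
    moreover have "(\<lambda>x. indicator K x *\<^sub>R f x) = f" using out by (auto simp: indicator_def fun_eq_iff)
    ultimately show ?thesis by simp
  qed
  have int_s: "(LINT x|lborel. s n x) = 0" for n
  proof -
    have e: "(LINT x|lborel. f (x + h n *\<^sub>R v)) = (LINT x|lborel. f x)"
      using integral_distr[of "(\<lambda>x. h n *\<^sub>R v + x)" lborel borel f] meas_f
      by (simp add: lborel_distr_plus add.commute[of _ "h n *\<^sub>R v"])
    have i: "integrable lborel (\<lambda>x. f (x + h n *\<^sub>R v))"
      using integrable_distr_eq[of "(\<lambda>x. h n *\<^sub>R v + x)" lborel borel f] meas_f intf
      by (simp add: lborel_distr_plus add.commute[of _ "h n *\<^sub>R v"])
    show ?thesis unfolding s_def using e i intf by simp
  qed
  have bound: "norm (s n x) \<le> B * indicat_real (cball 0 R') x" for n x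
  proof (cases "x \<in> cball 0 R'")
    case True
    obtain z where z: "0 < z" "z < h n" "f (x + h n *\<^sub>R v) - f (x + 0 *\<^sub>R v) = (h n - 0) * f' (x + z *\<^sub>R v)"
      using MVT2[of 0 "h n" "\<lambda>t. f (x + t *\<^sub>R v)" "\<lambda>t. f' (x + t *\<^sub>R v)"] h der' by auto
    then have "s n x = f' (x + z *\<^sub>R v)" using h[of n] by (simp add: s_def)
    then show ?thesis using B True by simp
  next
    case False
    have "x \<notin> K" using R[of x] False norm_ge_zero[of v] by (auto simp: R'_def simp del: norm_ge_zero)
    moreover have "x + h n *\<^sub>R v \<notin> K"
    proof
      assume "x + h n *\<^sub>R v \<in> K"
      then have "norm (x + h n *\<^sub>R v) \<le> R" by (rule R)
      moreover have "norm x \<le> norm (x + h n *\<^sub>R v) + norm (h n *\<^sub>R v)"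
        using norm_triangle_ineq4[of "x + h n *\<^sub>R v" "h n *\<^sub>R v"] by simp
      moreover have "norm (h n *\<^sub>R v) \<le> norm v" using h[of n] by (simp add: mult_left_le_one_le)
      ultimately show False using False by (simp add: R'_def)
    qed
    ultimately show ?thesis using False out by (simp add: s_def)
  qed
  have lim: "(\<lambda>n. s n x) \<longlonglongrightarrow> f' x" for x
  proof -
    have "((\<lambda>t. (f (x + t *\<^sub>R v) - f x) / t) \<longlongrightarrow> f' x) (at 0)"
      using der[of x] by (simp add: DERIV_def)
    moreover have "filterlim h (at 0) sequentially"
      unfolding filterlim_at h_def
    proof
      show "eventually (\<lambda>n. 1 / (real n + 1) \<in> UNIV \<and> 1 / (real n + 1) \<noteq> 0) sequentially"
        by (intro always_eventually) auto
      show "(\<lambda>n. 1 / (real n + 1)) \<longlonglongrightarrow> 0" by real_asymp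
    qed
    ultimately show ?thesis unfolding s_def by (rule filterlim_compose)
  qed
  have ind: "integrable lborel (\<lambda>x. B * indicat_real (cball 0 R' :: 'a set) x)"
    by (intro integrable_mult_right integrable_real_indicator)
      (use emeasure_bounded_finite[of "cball 0 R' :: 'a set"] in auto)
  show "integrable lborel f'"
    by (rule integrable_dominated_convergence[OF _ _ ind, of f' s])
       (use meas_f' meas_s lim bound in auto)
  have "(\<lambda>n. LINT x|lborel. s n x) \<longlonglongrightarrow> (LINT x|lborel. f' x)"
    by (rule integral_dominated_convergence[OF _ _ ind])
       (use meas_f' meas_s lim bound in auto)
  then show "(LINT x|lborel. f' x) = 0" unfolding int_s using LIMSEQ_unique tendsto_const by metis
qed

text \<open>
  The divergence theorem for the compactly supported field \<open>h E\<close>, with the divergence expanded by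
  the product rule. Below, \<open>E\<close> is a fixed smooth field on the ball, and only \<open>h\<close> carries the
  test function and the cut-offs.
\<close>

lemma integral_div_scaleR_eq_0:
  fixes E :: "'a::euclidean_space \<Rightarrow> 'a" and h :: "'a \<Rightarrow> real"
  assumes S: "open S" and K: "compact K" "K \<subseteq> S" and out: "\<And>x. x \<notin> K \<Longrightarrow> h x = 0"
    and h: "\<And>x. x \<in> S \<Longrightarrow> (h has_derivative h' x) (at x)" "\<And>v. continuous_on S (\<lambda>x. h' x v)"
    and E: "\<And>x. x \<in> S \<Longrightarrow> (E has_derivative E' x) (at x)" "\<And>v. continuous_on S (\<lambda>x. E' x v)"
  defines "D \<equiv> (\<lambda>x. if x \<in> S then h' x (E x) + h x * (\<Sum>b\<in>Basis. E' x b \<bullet> b) else 0)"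
  shows "integrable lborel D" "(LINT x|lborel. D x) = 0"
proof -
  define X where "X = (\<lambda>x. h x *\<^sub>R E x)"
  define d where "d = (\<lambda>b x. if x \<in> S then (h x *\<^sub>R E' x b + h' x b *\<^sub>R E x) \<bullet> b else 0)"
  have oK: "open (- K)" using K by (simp add: compact_imp_closed open_Compl)
  have cover: "S \<union> (- K) = UNIV" using K by auto
  have XD: "(X has_derivative (\<lambda>v. h x *\<^sub>R E' x v + h' x v *\<^sub>R E x)) (at x)" if "x \<in> S" for x
    unfolding X_def by (rule has_derivative_scaleR[OF h(1)[OF that] E(1)[OF that]])
  have cE: "continuous_on S E"
    using E(1) S by (meson continuous_on_eq_continuous_at has_derivative_continuous)
  have ch: "continuous_on S h"
    using h(1) S by (meson continuous_on_eq_continuous_at has_derivative_continuous)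
  have cX: "continuous_on UNIV X"
  proof -
    have "continuous_on S X" unfolding X_def by (intro continuous_intros ch cE)
    moreover have "continuous_on (- K) X"
      by (rule continuous_on_eq[OF continuous_on_const[of _ 0]]) (use out in \<open>auto simp: X_def\<close>)
    ultimately show ?thesis using continuous_on_open_Un[OF S oK] cover by metis
  qed
  have h'0: "h' x v = 0" if "x \<in> S" "x \<notin> K" for x v
  proof -
    have "((\<lambda>x. 0::real) has_derivative h' x) (at x)"
      by (rule has_derivative_transform_within_open[OF h(1)[OF that(1)] oK]) (use that out in auto)
    then have "h' x = (\<lambda>v. 0)" using has_derivative_unique has_derivative_const by blast
    then show ?thesis by simp
  qed
  have cd: "continuous_on UNIV (d b)" for b
  proof -
    have "continuous_on S (\<lambda>x. (h x *\<^sub>R E' x b + h' x b *\<^sub>R E x) \<bullet> b)"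
      by (intro continuous_intros ch cE h(2) E(2))
    then have "continuous_on S (d b)" by (rule continuous_on_eq) (simp add: d_def)
    moreover have "continuous_on (- K) (d b)"
      by (rule continuous_on_eq[OF continuous_on_const[of _ 0]]) (use out h'0 in \<open>auto simp: d_def\<close>)
    ultimately show ?thesis using continuous_on_open_Un[OF S oK] cover by metis
  qed
  have der: "((\<lambda>t. X (x + t *\<^sub>R b) \<bullet> b) has_real_derivative d b x) (at 0)" for x b
  proof (cases "x \<in> S")
    case True
    have "((\<lambda>t. x + t *\<^sub>R b) has_derivative (\<lambda>t. t *\<^sub>R b)) (at 0)"
      by (auto intro!: derivative_eq_intros)
    then have "((\<lambda>t. X (x + t *\<^sub>R b)) has_derivative (\<lambda>t. h x *\<^sub>R E' x (t *\<^sub>R b) + h' x (t *\<^sub>R b) *\<^sub>R E x)) (at 0)"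
      using has_derivative_compose[of "\<lambda>t. x + t *\<^sub>R b" _ 0 UNIV X] XD[OF True] by simp
    then have "((\<lambda>t. X (x + t *\<^sub>R b) \<bullet> b) has_derivative (\<lambda>t. (h x *\<^sub>R E' x (t *\<^sub>R b) + h' x (t *\<^sub>R b) *\<^sub>R E x) \<bullet> b)) (at 0)"
      by (rule has_derivative_inner_left)
    moreover have "(\<lambda>t. (h x *\<^sub>R E' x (t *\<^sub>R b) + h' x (t *\<^sub>R b) *\<^sub>R E x) \<bullet> b) = (\<lambda>t. d b x * t)"
      using True linear_scale[OF has_derivative_linear[OF E(1)[OF True]]]
        linear_scale[OF has_derivative_linear[OF h(1)[OF True]]]
      by (auto simp: d_def algebra_simps)
    ultimately show ?thesis by (simp add: has_field_derivative_def)
  next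
    case False
    then have x: "x \<in> - K" using K by auto
    have "((\<lambda>t. x + t *\<^sub>R b) \<longlongrightarrow> x) (at 0)"
      by (auto intro!: tendsto_eq_intros)
    then have "eventually (\<lambda>t. x + t *\<^sub>R b \<in> - K) (at 0)"
      using oK x by (intro topological_tendstoD) auto
    then have "eventually (\<lambda>t. X (x + t *\<^sub>R b) \<bullet> b = 0) (nhds 0)"
      unfolding eventually_nhds_conv_at using x by (auto elim!: eventually_mono simp: X_def out)
    then have "((\<lambda>t. X (x + t *\<^sub>R b) \<bullet> b) has_real_derivative 0) (at 0)"
      by (subst DERIV_cong_ev[OF refl _ refl, where g="\<lambda>_. 0"]) auto
    then show ?thesis using False by (simp add: d_def)
  qed
  have main: "integrable lborel (d b)" "(LINT x|lborel. d b x) = 0" for b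
    using integral_directional_derivative_eq_0[OF K(1) _ der _ cd, of b] out
      continuous_on_inner[OF cX continuous_on_const] by (auto simp: X_def)
  have D_eq: "D = (\<lambda>x. \<Sum>b\<in>Basis. d b x)"
  proof
    fix x
    show "D x = (\<Sum>b\<in>Basis. d b x)"
    proof (cases "x \<in> S")
      case True
      have "h' x (E x) = h' x (\<Sum>b\<in>Basis. (E x \<bullet> b) *\<^sub>R b)" by (simp add: euclidean_representation)
      also have "\<dots> = (\<Sum>b\<in>Basis. (E x \<bullet> b) * h' x b)"
        using has_derivative_linear[OF h(1)[OF True]] by (simp add: linear_sum linear_scale)
      finally show ?thesis using True
        by (simp add: D_def d_def inner_add_left sum.distrib sum_distrib_left mult.commute)
    qed (simp add: D_def d_def)
  qed
  show "integrable lborel D" "(LINT x|lborel. D x) = 0"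
    unfolding D_eq using main by auto
qed

section \<open>The hyperbolic cosine of the distance in the ball model\<close>

definition conf_factor :: "'a::real_inner \<Rightarrow> real" where
  "conf_factor x = 2 / (1 - (norm x)\<^sup>2)"

definition cosh_dist :: "'a::real_inner \<Rightarrow> 'a \<Rightarrow> real" where
  "cosh_dist y x = 1 + conf_factor x * conf_factor y * (norm (x - y))\<^sup>2 / 2"

definition grad_cosh_dist :: "'a::real_inner \<Rightarrow> 'a \<Rightarrow> 'a" where
  "grad_cosh_dist y x =
     ((conf_factor x)\<^sup>2 * (conf_factor y - 1 - conf_factor y * (x \<bullet> y))) *\<^sub>R x - (conf_factor x * conf_factor y) *\<^sub>R y"

lemma norm_sq_less_1: "norm x < 1 \<Longrightarrow> (norm x)\<^sup>2 < 1"
  using power_strict_mono[of "norm x" 1 2] by simp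

lemma conf_factor_pos: "norm x < 1 \<Longrightarrow> conf_factor x > 0"
  using norm_sq_less_1[of x] by (simp add: conf_factor_def)

lemma inner_self_eq_conf_factor: "norm x < 1 \<Longrightarrow> x \<bullet> x = 1 - 2 / conf_factor x"
  using norm_sq_less_1[of x] by (simp add: conf_factor_def power2_norm_eq_inner field_simps)

lemma cosh_dist_ge_1: "norm x < 1 \<Longrightarrow> norm y < 1 \<Longrightarrow> cosh_dist y x \<ge> 1"
  using conf_factor_pos[of x] conf_factor_pos[of y] by (simp add: cosh_dist_def)

lemma cosh_dist_eq_1_iff: "norm x < 1 \<Longrightarrow> norm y < 1 \<Longrightarrow> cosh_dist y x = 1 \<longleftrightarrow> x = y"
  using conf_factor_pos[of x] conf_factor_pos[of y] by (simp add: cosh_dist_def)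

lemma cosh_dist_commute: "cosh_dist x y = cosh_dist y x"
  by (simp add: cosh_dist_def norm_minus_commute)

text \<open>
  In this form \<open>cosh_dist y\<close> is the conformal factor times an affine function, plus a constant,
  which makes its gradient and its Laplacian easy to compute.
\<close>

lemma cosh_dist_eq:
  assumes "norm x < 1" "norm y < 1"
  shows "cosh_dist y x = conf_factor x * conf_factor y * (1 - x \<bullet> y) - conf_factor x - conf_factor y + 1"
proof -
  have "(norm (x - y))\<^sup>2 = (1 - 2 / conf_factor x) + (1 - 2 / conf_factor y) - 2 * (x \<bullet> y)"
    using inner_self_eq_conf_factor[OF assms(1)] inner_self_eq_conf_factor[OF assms(2)]
    by (simp add: power2_norm_eq_inner inner_diff_left inner_diff_right inner_commute)
  then show ?thesis using conf_factor_pos[OF assms(1)] conf_factor_pos[OF assms(2)]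
    by (simp add: cosh_dist_def field_simps)
qed

text \<open>
  The distance function has gradient of length \<open>1\<close>, hence its hyperbolic cosine has
  gradient of length \<open>sinh\<close>; the factor \<open>(conf_factor x)\<^sup>2\<close> converts the hyperbolic length
  into the Euclidean one. Being an identity of rational functions, it holds at \<open>y\<close> too.
\<close>

lemma grad_cosh_dist_sq:
  assumes "norm x < 1" "norm y < 1"
  shows "grad_cosh_dist y x \<bullet> grad_cosh_dist y x = (conf_factor x)\<^sup>2 * ((cosh_dist y x)\<^sup>2 - 1)"
proof -
  define q p t where "q = conf_factor x" "p = conf_factor y" "t = x \<bullet> y"
  have qp: "q > 0" "p > 0" using conf_factor_pos assms by (auto simp: q_p_t_def)
  have "grad_cosh_dist y x \<bullet> grad_cosh_dist y x =
     (q\<^sup>2 * (p - 1 - p * t))\<^sup>2 * (x \<bullet> x) - 2 * (q\<^sup>2 * (p - 1 - p * t)) * (q * p) * t + (q * p)\<^sup>2 * (y \<bullet> y)"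
    unfolding grad_cosh_dist_def q_p_t_def
    by (simp add: inner_diff_left inner_diff_right inner_commute power2_eq_square algebra_simps)
  also have "x \<bullet> x = 1 - 2 / q"
    using inner_self_eq_conf_factor assms by (auto simp: q_p_t_def)
  also have "y \<bullet> y = 1 - 2 / p"
    using inner_self_eq_conf_factor assms by (auto simp: q_p_t_def)
  also have "(q\<^sup>2 * (p - 1 - p * t))\<^sup>2 * (1 - 2 / q) - 2 * (q\<^sup>2 * (p - 1 - p * t)) * (q * p) * t + (q * p)\<^sup>2 * (1 - 2 / p)
      = q\<^sup>2 * ((q * p * (1 - t) - q - p + 1)\<^sup>2 - 1)"
    using qp by (simp add: field_simps power2_eq_square)
  also have "q * p * (1 - t) - q - p + 1 = cosh_dist y x"
    using cosh_dist_eq[OF assms] by (simp add: q_p_t_def)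
  finally show ?thesis by (simp add: q_p_t_def)
qed

lemma conf_factor_has_derivative:
  fixes x :: "'a::real_inner"
  assumes "norm x < 1"
  shows "(conf_factor has_derivative (\<lambda>v. (conf_factor x)\<^sup>2 * (x \<bullet> v))) (at x)"
proof -
  have "1 - x \<bullet> x \<noteq> 0" using norm_sq_less_1[OF assms] by (simp add: power2_norm_eq_inner)
  then have "((\<lambda>x. 2 / (1 - x \<bullet> x)) has_derivative (\<lambda>v. (2 / (1 - x \<bullet> x))\<^sup>2 * (x \<bullet> v))) (at x)"
    by (auto intro!: derivative_eq_intros simp: fun_eq_iff inner_commute power2_eq_square)
  then show ?thesis by (simp add: conf_factor_def[abs_def] power2_norm_eq_inner)
qed

lemma cosh_dist_has_derivative:
  fixes x :: "'a::real_inner"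
  assumes "norm x < 1" "norm y < 1"
  shows "(cosh_dist y has_derivative (\<lambda>v. grad_cosh_dist y x \<bullet> v)) (at x)"
proof -
  have "((\<lambda>x. conf_factor x * conf_factor y * (1 - x \<bullet> y) - conf_factor x - conf_factor y + 1) has_derivative
     (\<lambda>v. grad_cosh_dist y x \<bullet> v)) (at x)"
    by (auto intro!: derivative_eq_intros conf_factor_has_derivative[OF assms(1)]
        simp: fun_eq_iff grad_cosh_dist_def algebra_simps inner_commute)
  then show ?thesis
    by (rule has_derivative_transform_within_open[OF _ open_ball[of 0 1]])
       (use assms in \<open>auto simp: cosh_dist_eq\<close>)
qed

lemma continuous_on_conf_factor [continuous_intros]: "continuous_on (ball (0::'a::real_inner) 1) conf_factor"
proof -
  have "\<forall>x\<in>ball 0 1. 1 - (norm (x::'a))\<^sup>2 \<noteq> 0"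
    by (metis norm_sq_less_1 mem_ball_0 diff_gt_0_iff_gt less_irrefl)
  then show ?thesis unfolding conf_factor_def by (intro continuous_intros)
qed

lemma continuous_on_cosh_dist [continuous_intros]: "continuous_on (ball 0 1) (cosh_dist y)"
  unfolding cosh_dist_def by (intro continuous_intros) auto

lemma continuous_on_grad_cosh_dist [continuous_intros]: "continuous_on (ball 0 1) (grad_cosh_dist y)"
  unfolding grad_cosh_dist_def by (intro continuous_intros)

text \<open>
  With \<open>n = N - 2\<close> in dimension \<open>N\<close>, the Euclidean divergence of this field is the hyperbolic
  Laplacian of \<open>cosh_dist y\<close> times the volume density \<open>q\<^sup>N\<close>.
\<close>

definition weighted_grad :: "nat \<Rightarrow> 'a::real_inner \<Rightarrow> 'a \<Rightarrow> 'a" where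
  "weighted_grad n y x = conf_factor x ^ n *\<^sub>R grad_cosh_dist y x"

definition weighted_grad' :: "nat \<Rightarrow> 'a::real_inner \<Rightarrow> 'a \<Rightarrow> 'a \<Rightarrow> 'a" where
  "weighted_grad' n y x v =
     (conf_factor x ^ (n + 2) * (conf_factor y - 1 - conf_factor y * (x \<bullet> y))) *\<^sub>R v
     + (real (n + 2) * conf_factor x ^ (n + 3) * (x \<bullet> v) * (conf_factor y - 1 - conf_factor y * (x \<bullet> y))
        - conf_factor x ^ (n + 2) * conf_factor y * (v \<bullet> y)) *\<^sub>R x
     - (real (n + 1) * conf_factor x ^ (n + 2) * (x \<bullet> v) * conf_factor y) *\<^sub>R y"

lemma weighted_grad_has_derivative:
  fixes x :: "'a::real_inner"
  assumes "norm x < 1"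
  shows "(weighted_grad n y has_derivative weighted_grad' n y x) (at x)"
proof -
  have e: "weighted_grad n y = (\<lambda>x. (conf_factor x ^ (n + 2) * (conf_factor y - 1 - conf_factor y * (x \<bullet> y))) *\<^sub>R x
      - (conf_factor x ^ (n + 1) * conf_factor y) *\<^sub>R y)"
    by (simp add: weighted_grad_def grad_cosh_dist_def fun_eq_iff algebra_simps power2_eq_square)
  have p: "((\<lambda>x. conf_factor x ^ m) has_derivative (\<lambda>v. real m * conf_factor x ^ (m + 1) * (x \<bullet> v))) (at x)" if "m > 0" for m
  proof -
    have "conf_factor x ^ (m - 1) * (conf_factor x)\<^sup>2 = conf_factor x ^ (m + 1)"
      using that by (cases m) (simp_all add: power2_eq_square)
    then show ?thesis
      using has_derivative_power[OF conf_factor_has_derivative[OF assms], of m] by (simp add: mult_ac)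
  qed
  have l: "((\<lambda>x. conf_factor y - 1 - conf_factor y * (x \<bullet> y)) has_derivative (\<lambda>v. - (conf_factor y * (v \<bullet> y)))) (at x)"
    by (auto intro!: derivative_eq_intros)
  have "((\<lambda>x. (conf_factor x ^ (n + 2) * (conf_factor y - 1 - conf_factor y * (x \<bullet> y))) *\<^sub>R x
      - (conf_factor x ^ (n + 1) * conf_factor y) *\<^sub>R y) has_derivative
      (\<lambda>v. ((conf_factor x ^ (n + 2) * (conf_factor y - 1 - conf_factor y * (x \<bullet> y))) *\<^sub>R v
        + (conf_factor x ^ (n + 2) * - (conf_factor y * (v \<bullet> y)) +
           real (n + 2) * conf_factor x ^ (n + 2 + 1) * (x \<bullet> v) * (conf_factor y - 1 - conf_factor y * (x \<bullet> y))) *\<^sub>R x)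
      - (real (n + 1) * conf_factor x ^ (n + 1 + 1) * (x \<bullet> v) * conf_factor y) *\<^sub>R y)) (at x)"
    by (intro has_derivative_diff has_derivative_scaleR has_derivative_mult l p has_derivative_ident
        has_derivative_scaleR_left has_derivative_mult_left) auto
  then show ?thesis unfolding e
    by (rule has_derivative_eq_rhs)
       (simp add: fun_eq_iff weighted_grad'_def algebra_simps inner_commute eval_nat_numeral)
qed

lemma continuous_on_weighted_grad': "continuous_on (ball 0 1) (\<lambda>x. weighted_grad' n y x v)"
  unfolding weighted_grad'_def by (intro continuous_intros)

text \<open>
  This is the equation \<open>\<Delta> c = N c\<close> for the hyperbolic cosine \<open>c\<close> of the distance from a point.
\<close>

lemma divergence_weighted_grad:
  fixes x :: "'a::euclidean_space"
  assumes "norm x < 1" "norm y < 1" and n: "DIM('a) = n + 2"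
  shows "(\<Sum>b\<in>Basis. weighted_grad' n y x b \<bullet> b) = real DIM('a) * conf_factor x ^ DIM('a) * cosh_dist y x"
proof -
  define q p t where "q = conf_factor x" "p = conf_factor y" "t = x \<bullet> y"
  have qp: "q > 0" "p > 0" using conf_factor_pos assms by (auto simp: q_p_t_def)
  have i: "(\<Sum>b\<in>Basis. (z \<bullet> b) * (w \<bullet> b)) = z \<bullet> w" for z w :: 'a
    by (rule euclidean_inner[symmetric])
  have "(\<Sum>b\<in>Basis. weighted_grad' n y x b \<bullet> b) =
     (\<Sum>b\<in>Basis. (q ^ (n + 2) * (p - 1 - p * t)) * (b \<bullet> b)
       + real (n + 2) * q ^ (n + 3) * (p - 1 - p * t) * ((x \<bullet> b) * (x \<bullet> b))
       - q ^ (n + 2) * p * ((y \<bullet> b) * (x \<bullet> b))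
       - real (n + 1) * q ^ (n + 2) * p * ((x \<bullet> b) * (y \<bullet> b)))"
    unfolding weighted_grad'_def q_p_t_def
    by (intro sum.cong refl) (simp add: inner_add_left inner_diff_left algebra_simps inner_commute)
  also have "\<dots> = (q ^ (n + 2) * (p - 1 - p * t)) * real (n + 2)
       + real (n + 2) * q ^ (n + 3) * (p - 1 - p * t) * (x \<bullet> x)
       - q ^ (n + 2) * p * t - real (n + 1) * q ^ (n + 2) * p * t"
    unfolding sum_subtractf sum.distrib sum_distrib_left[symmetric] i
    using n by (simp add: q_p_t_def inner_commute)
  also have "x \<bullet> x = 1 - 2 / q"
    using inner_self_eq_conf_factor assms by (auto simp: q_p_t_def)
  also have "(q ^ (n + 2) * (p - 1 - p * t)) * real (n + 2)
       + real (n + 2) * q ^ (n + 3) * (p - 1 - p * t) * (1 - 2 / q)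
       - q ^ (n + 2) * p * t - real (n + 1) * q ^ (n + 2) * p * t
      = real (n + 2) * q ^ (n + 2) * (q * p * (1 - t) - q - p + 1)"
    using qp by (simp add: field_simps power_add power2_eq_square power3_eq_cube)
  also have "q * p * (1 - t) - q - p + 1 = cosh_dist y x"
    using cosh_dist_eq[OF assms(1,2)] by (simp add: q_p_t_def)
  finally show ?thesis by (simp add: q_p_t_def n)
qed

section \<open>Hyperbolic distance\<close>

lemma hyp_norm_eq: "norm x < 1 \<Longrightarrow> hyp_norm x v = conf_factor x * norm v"
  using norm_sq_less_1[of x] unfolding hyp_norm_def hyp_metric_def conf_factor_def
  by (simp add: real_sqrt_mult real_sqrt_divide norm_eq_sqrt_inner)

text \<open>
  The function \<open>arcosh (cosh_dist z x)\<close> is \<open>1\<close>-Lipschitz in \<open>x\<close> along curves, since its gradient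
  has length at most \<open>1\<close>. It is not differentiable at \<open>z\<close>, so the estimate is first proved
  for \<open>arcosh (cosh_dist z x + \<delta>)\<close> with \<open>\<delta> > 0\<close>, which is smooth everywhere and has a smaller
  gradient.
\<close>

lemma arcosh_cosh_dist_le_add_length:
  fixes \<gamma> :: "real \<Rightarrow> real ^ 'n"
  assumes C1: "\<gamma> C1_differentiable_on {0..1}" and img: "path_image \<gamma> \<subseteq> hyp_space" and z: "norm z < 1"
  shows "arcosh (cosh_dist z (pathfinish \<gamma>)) \<le> arcosh (cosh_dist z (pathstart \<gamma>)) + hyp_length \<gamma>"
proof -
  obtain D where D: "\<And>t. t \<in> {0..1} \<Longrightarrow> (\<gamma> has_vector_derivative D t) (at t)"
    and cD: "continuous_on {0..1} D"
    using C1 unfolding C1_differentiable_on_def by blast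
  have in_ball: "norm (\<gamma> t) < 1" if "t \<in> {0..1}" for t
  proof -
    have "\<gamma> t \<in> ball 0 1" using that img unfolding path_image_def hyp_space_def by blast
    then show ?thesis by simp
  qed
  define g where "g = (\<lambda>t. cosh_dist z (\<gamma> t))"
  have g1: "g t \<ge> 1" if "t \<in> {0..1}" for t
    using cosh_dist_ge_1 in_ball[OF that] z by (simp add: g_def)
  have gd: "(g has_real_derivative grad_cosh_dist z (\<gamma> t) \<bullet> D t) (at t)" if "t \<in> {0..1}" for t
  proof -
    have "((\<lambda>t. cosh_dist z (\<gamma> t)) has_derivative (\<lambda>s. grad_cosh_dist z (\<gamma> t) \<bullet> (s *\<^sub>R D t))) (at t)"
      using D[OF that] cosh_dist_has_derivative[OF in_ball[OF that] z] unfolding has_vector_derivative_def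
      by (rule has_derivative_compose)
    then show ?thesis
      unfolding g_def has_field_derivative_def by (rule has_derivative_eq_rhs) (simp add: fun_eq_iff)
  qed
  have c\<gamma>: "continuous_on {0..1} \<gamma>"
    using D by (meson continuous_at_imp_continuous_on has_vector_derivative_continuous)
  have int: "((\<lambda>t. conf_factor (\<gamma> t) * norm (D t)) has_integral hyp_length \<gamma>) {0..1}"
  proof -
    have "continuous_on {0..1} (\<lambda>t. conf_factor (\<gamma> t) * norm (D t))"
      by (intro continuous_intros cD continuous_on_compose2[OF continuous_on_conf_factor c\<gamma>])
        (use in_ball in auto)
    then have "((\<lambda>t. conf_factor (\<gamma> t) * norm (D t)) has_integral integral {0..1} (\<lambda>t. conf_factor (\<gamma> t) * norm (D t))) {0..1}"
      by (intro integrable_integral integrable_continuous_real)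
    moreover have "integral {0..1} (\<lambda>t. conf_factor (\<gamma> t) * norm (D t)) = hyp_length \<gamma>"
      unfolding hyp_length_def using vector_derivative_at[OF D] in_ball
      by (intro integral_cong) (simp add: hyp_norm_eq)
    ultimately show ?thesis by simp
  qed
  have le: "arcosh (g 1 + \<delta>) \<le> arcosh (g 0 + \<delta>) + hyp_length \<gamma>" if \<delta>: "\<delta> > 0" for \<delta>
  proof -
    let ?F' = "\<lambda>t. (grad_cosh_dist z (\<gamma> t) \<bullet> D t) / sqrt ((g t + \<delta>)\<^sup>2 - 1)"
    have "((\<lambda>t. arcosh (g t + \<delta>)) has_real_derivative ?F' t) (at t)" if t: "t \<in> {0..1}" for t
    proof -
      have "((\<lambda>t. g t + \<delta>) has_real_derivative grad_cosh_dist z (\<gamma> t) \<bullet> D t) (at t)"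
        using gd[OF t] by (auto intro!: derivative_eq_intros)
      from DERIV_chain2[OF arcosh_real_has_field_derivative this] show ?thesis
        using g1[OF t] \<delta> by simp
    qed
    then have i1: "(?F' has_integral arcosh (g 1 + \<delta>) - arcosh (g 0 + \<delta>)) {0..1}"
      by (intro fundamental_theorem_of_calculus)
        (auto simp: has_real_derivative_iff_has_vector_derivative[symmetric] intro: has_field_derivative_at_within)
    have bd: "?F' t \<le> conf_factor (\<gamma> t) * norm (D t)" if t: "t \<in> {0..1}" for t
    proof -
      have "(g t)\<^sup>2 \<le> (g t + \<delta>)\<^sup>2" using g1[OF t] \<delta> by (intro power_mono) auto
      moreover have "(g t)\<^sup>2 \<ge> 1" using g1[OF t] by simp
      moreover have "1 < (g t + \<delta>)\<^sup>2" using g1[OF t] \<delta> by (intro one_less_power) auto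
      ultimately have s: "sqrt ((g t)\<^sup>2 - 1) \<le> sqrt ((g t + \<delta>)\<^sup>2 - 1)" "sqrt ((g t + \<delta>)\<^sup>2 - 1) > 0"
        by auto
      have "norm (grad_cosh_dist z (\<gamma> t)) = conf_factor (\<gamma> t) * sqrt ((g t)\<^sup>2 - 1)"
        using grad_cosh_dist_sq[OF in_ball[OF t] z] conf_factor_pos[OF in_ball[OF t]]
        by (simp add: norm_eq_sqrt_inner real_sqrt_mult g_def)
      then have "grad_cosh_dist z (\<gamma> t) \<bullet> D t \<le> (conf_factor (\<gamma> t) * sqrt ((g t)\<^sup>2 - 1)) * norm (D t)"
        using norm_cauchy_schwarz[of "grad_cosh_dist z (\<gamma> t)" "D t"] by simp
      also have "\<dots> \<le> (conf_factor (\<gamma> t) * sqrt ((g t + \<delta>)\<^sup>2 - 1)) * norm (D t)"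
        using s conf_factor_pos[OF in_ball[OF t]] by (intro mult_right_mono mult_left_mono) auto
      finally show ?thesis using s by (simp add: pos_divide_le_eq mult_ac)
    qed
    have "arcosh (g 1 + \<delta>) - arcosh (g 0 + \<delta>) \<le> hyp_length \<gamma>"
      by (rule has_integral_le[OF i1 int bd])
    then show ?thesis by simp
  qed
  have lim: "((\<lambda>\<delta>. arcosh (g t + \<delta>)) \<longlongrightarrow> arcosh (g t)) (at_right 0)" if "t \<in> {0..1}" for t
  proof (rule tendsto_arcosh_strong)
    show "((\<lambda>\<delta>. g t + \<delta>) \<longlongrightarrow> g t) (at_right 0)" by (auto intro!: tendsto_eq_intros)
    show "eventually (\<lambda>\<delta>. g t + \<delta> \<ge> 1) (at_right 0)"
      using g1[OF that] by (auto simp: eventually_at_filter)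
  qed (use g1[OF that] in auto)
  have "arcosh (g 1) \<le> arcosh (g 0) + hyp_length \<gamma>"
  proof (rule tendsto_le[OF trivial_limit_at_right_real _ lim])
    show "((\<lambda>\<delta>. arcosh (g 0 + \<delta>) + hyp_length \<gamma>) \<longlongrightarrow> arcosh (g 0) + hyp_length \<gamma>) (at_right 0)"
      by (intro tendsto_intros lim) auto
    show "eventually (\<lambda>\<delta>. arcosh (g 1 + \<delta>) \<le> arcosh (g 0 + \<delta>) + hyp_length \<gamma>) (at_right 0)"
      using le by (auto simp: eventually_at_filter)
  qed auto
  then show ?thesis by (simp add: g_def pathstart_def pathfinish_def)
qed

text \<open>
  The geodesic comes from the hyperboloid model: a point \<open>x\<close> of the ball corresponds to the vector
  with time component \<open>q - 1\<close> and space component \<open>q x\<close>, where \<open>q = conf_factor x\<close>, and the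
  geodesic between two points of the hyperboloid at distance \<open>L\<close> is their combination with
  coefficients \<open>sinh((1 - t) L) / sinh L\<close> and \<open>sinh(t L) / sinh L\<close>. The projection to the ball
  divides the space component \<open>S\<close> by one plus the time component \<open>T\<close>.
\<close>

lemma geodesic_exists:
  fixes x y :: "real ^ 'n"
  assumes x: "norm x < 1" and y: "norm y < 1"
  obtains \<gamma> where "\<gamma> C1_differentiable_on {0..1}" "path_image \<gamma> \<subseteq> hyp_space"
    "pathstart \<gamma> = x" "pathfinish \<gamma> = y" "hyp_length \<gamma> = arcosh (cosh_dist y x)"
proof (cases "x = y")
  case True
  have "hyp_length (\<lambda>_. x) = 0"
    unfolding hyp_length_def using x by (simp add: hyp_norm_eq)
  then show ?thesis
    using that[of "\<lambda>_. x"] True x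
    by (auto simp: path_image_def hyp_space_def pathstart_def pathfinish_def cosh_dist_def)
next
  case False
  define L where "L = arcosh (cosh_dist y x)"
  have c1: "cosh_dist y x > 1"
    using cosh_dist_ge_1[OF x y] cosh_dist_eq_1_iff[OF x y] False by simp
  have L: "L > 0" "cosh L = cosh_dist y x" using c1 by (auto simp: L_def)
  have sL: "sinh L > 0" using L by simp
  define p q where "p = conf_factor x" "q = conf_factor y"
  have pq: "p > 0" "q > 0" using conf_factor_pos x y by (auto simp: p_q_def)
  have p1: "p > 1" "q > 1"
  proof -
    have "0 \<le> x \<bullet> x" "0 \<le> y \<bullet> y" by auto
    then show "p > 1" "q > 1"
      using inner_self_eq_conf_factor[OF x] inner_self_eq_conf_factor[OF y] pq by (auto simp: p_q_def field_simps)
  qed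
  define a where "a = (\<lambda>t. sinh ((1 - t) * L) / sinh L)"
  define b where "b = (\<lambda>t. sinh (t * L) / sinh L)"
  define a' where "a' = (\<lambda>t. - (L * cosh ((1 - t) * L)) / sinh L)"
  define b' where "b' = (\<lambda>t. L * cosh (t * L) / sinh L)"
  define T where "T = (\<lambda>a b. a * (p - 1) + b * (q - 1))"
  define S where "S = (\<lambda>a b. (a * p) *\<^sub>R x + (b * q) *\<^sub>R y)"
  \<comment> \<open>The Minkowski product of two combinations; the product of the two end points is \<open>cosh L\<close>.\<close>
  have mink: "T a b * T a' b' - S a b \<bullet> S a' b' = a * a' + b * b' + (a * b' + a' * b) * cosh L" for a b a' b'
  proof -
    have xx: "p\<^sup>2 * (x \<bullet> x) = p\<^sup>2 - 2 * p"
      unfolding inner_self_eq_conf_factor[OF x] p_q_def[symmetric] using pq by (simp add: field_simps power2_eq_square)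
    have yy: "q\<^sup>2 * (y \<bullet> y) = q\<^sup>2 - 2 * q"
      unfolding inner_self_eq_conf_factor[OF y] p_q_def[symmetric] using pq by (simp add: field_simps power2_eq_square)
    have xy: "p * q * (x \<bullet> y) = p * q - cosh L - p - q + 1"
      using cosh_dist_eq[OF x y] by (simp add: L(2) p_q_def[symmetric] algebra_simps)
    have "S a b \<bullet> S a' b' = a * a' * (p\<^sup>2 * (x \<bullet> x)) + b * b' * (q\<^sup>2 * (y \<bullet> y))
        + (a * b' + a' * b) * (p * q * (x \<bullet> y))"
      by (simp add: S_def inner_add_left inner_add_right inner_commute power2_eq_square algebra_simps)
    then show ?thesis unfolding xx yy xy T_def
      by (simp add: algebra_simps power2_eq_square)
  qed
  have addL: "cosh L = cosh ((1 - t) * L) * cosh (t * L) + sinh ((1 - t) * L) * sinh (t * L)"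
    "sinh L = sinh ((1 - t) * L) * cosh (t * L) + cosh ((1 - t) * L) * sinh (t * L)" for t
    using cosh_add[of "(1 - t) * L" "t * L"] sinh_add[of "(1 - t) * L" "t * L"]
    by (simp_all add: algebra_simps)
  have csq: "(cosh r)\<^sup>2 = 1 + (sinh r)\<^sup>2" for r :: real by (simp add: cosh_square_eq)
  \<comment> \<open>The curve stays on the hyperboloid, its velocity is tangent to it and has Minkowski length \<open>L\<close>.\<close>
  have SS: "S (a t) (b t) \<bullet> S (a t) (b t) = (T (a t) (b t))\<^sup>2 - 1" for t
  proof -
    define A B C D where "A = sinh ((1 - t) * L)" "B = sinh (t * L)" "C = cosh ((1 - t) * L)" "D = cosh (t * L)"
    have q: "C\<^sup>2 = 1 + A\<^sup>2" "D\<^sup>2 = 1 + B\<^sup>2" using csq by (auto simp: A_B_C_D_def)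
    have "A\<^sup>2 + B\<^sup>2 + 2 * A * B * (C * D + A * B) = (A * D + C * B)\<^sup>2"
      using q by algebra
    then have e: "A\<^sup>2 + B\<^sup>2 + 2 * A * B * cosh L = (sinh L)\<^sup>2"
      using addL[of t] by (simp add: A_B_C_D_def)
    have "a t * a t + b t * b t + (a t * b t + a t * b t) * cosh L
       = (A\<^sup>2 + B\<^sup>2 + 2 * A * B * cosh L) / (sinh L)\<^sup>2"
      unfolding a_def b_def A_B_C_D_def[symmetric]
      using sL by (simp add: field_simps power2_eq_square)
    also have "\<dots> = 1" unfolding e using sL by simp
    finally show ?thesis using mink[of "a t" "b t" "a t" "b t"] by (simp add: power2_eq_square)
  qed
  have SS': "S (a t) (b t) \<bullet> S (a' t) (b' t) = T (a t) (b t) * T (a' t) (b' t)" for t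
  proof -
    define A B C D where "A = sinh ((1 - t) * L)" "B = sinh (t * L)" "C = cosh ((1 - t) * L)" "D = cosh (t * L)"
    have q: "C\<^sup>2 = 1 + A\<^sup>2" "D\<^sup>2 = 1 + B\<^sup>2" using csq by (auto simp: A_B_C_D_def)
    have "- (A * C) + B * D + (A * D - C * B) * (C * D + A * B) = 0"
      using q by algebra
    then have e: "- (A * C) + B * D + (A * D - C * B) * cosh L = 0"
      using addL[of t] by (simp add: A_B_C_D_def)
    have "a t * a' t + b t * b' t + (a t * b' t + a' t * b t) * cosh L
       = L / (sinh L)\<^sup>2 * (- (A * C) + B * D + (A * D - C * B) * cosh L)"
      unfolding a_def b_def a'_def b'_def A_B_C_D_def[symmetric]
      using sL by (simp add: field_simps power2_eq_square)
    then show ?thesis using mink[of "a t" "b t" "a' t" "b' t"] e by simp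
  qed
  have S'S': "S (a' t) (b' t) \<bullet> S (a' t) (b' t) = (T (a' t) (b' t))\<^sup>2 + L\<^sup>2" for t
  proof -
    define A B C D where "A = sinh ((1 - t) * L)" "B = sinh (t * L)" "C = cosh ((1 - t) * L)" "D = cosh (t * L)"
    have q: "C\<^sup>2 = 1 + A\<^sup>2" "D\<^sup>2 = 1 + B\<^sup>2" using csq by (auto simp: A_B_C_D_def)
    have "C\<^sup>2 + D\<^sup>2 - 2 * C * D * (C * D + A * B) = - ((A * D + C * B)\<^sup>2)"
      using q by algebra
    then have e: "C\<^sup>2 + D\<^sup>2 - 2 * C * D * cosh L = - ((sinh L)\<^sup>2)"
      using addL[of t] by (simp add: A_B_C_D_def)
    have "a' t * a' t + b' t * b' t + (a' t * b' t + a' t * b' t) * cosh L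
       = L\<^sup>2 / (sinh L)\<^sup>2 * (C\<^sup>2 + D\<^sup>2 - 2 * C * D * cosh L)"
      unfolding a'_def b'_def A_B_C_D_def[symmetric]
      using sL by (simp add: field_simps power2_eq_square)
    also have "\<dots> = - (L\<^sup>2)" unfolding e using sL by simp
    finally show ?thesis using mink[of "a' t" "b' t" "a' t" "b' t"] by (simp add: power2_eq_square)
  qed
  have T_pos: "T (a t) (b t) > 0" if "t \<in> {0..1}" for t
  proof -
    have ab: "a t \<ge> 0" "b t \<ge> 0" using that L sL by (auto simp: a_def b_def)
    moreover have "a t > 0 \<or> b t > 0" using that L sL by (cases "t = 0") (auto simp: a_def b_def)
    ultimately show ?thesis using p1 unfolding T_def
      by (auto intro: add_pos_nonneg add_nonneg_pos)
  qed
  define \<gamma> where "\<gamma> = (\<lambda>t. (1 / (1 + T (a t) (b t))) *\<^sub>R S (a t) (b t))"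
  define D where "D = (\<lambda>t. (1 / (1 + T (a t) (b t))) *\<^sub>R S (a' t) (b' t)
     - (T (a' t) (b' t) / (1 + T (a t) (b t))\<^sup>2) *\<^sub>R S (a t) (b t))"
  have da: "(a has_real_derivative a' t) (at t)" "(b has_real_derivative b' t) (at t)" for t
    unfolding a_def b_def a'_def b'_def using sL
    by (auto intro!: derivative_eq_intros simp: field_simps)
  have dT: "((\<lambda>t. T (a t) (b t)) has_real_derivative T (a' t) (b' t)) (at t)" for t
    unfolding T_def by (auto intro!: derivative_eq_intros da)
  have dS: "((\<lambda>t. S (a t) (b t)) has_vector_derivative S (a' t) (b' t)) (at t)" for t
    unfolding S_def by (auto intro!: derivative_eq_intros da)
  have dg: "(\<gamma> has_vector_derivative D t) (at t)" if "t \<in> {0..1}" for t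
  proof -
    have "((\<lambda>t. 1 / (1 + T (a t) (b t))) has_real_derivative - (T (a' t) (b' t) / (1 + T (a t) (b t))\<^sup>2)) (at t)"
      using T_pos[OF that] by (auto intro!: derivative_eq_intros dT simp: power2_eq_square)
    from has_vector_derivative_scaleR[OF this dS] show ?thesis
      unfolding \<gamma>_def D_def by (simp add: algebra_simps)
  qed
  have cD: "continuous_on {0..1} D"
  proof -
    have "\<forall>t\<in>{0..1}. 1 + T (a t) (b t) \<noteq> 0" "\<forall>t\<in>{0..1}. (1 + T (a t) (b t))\<^sup>2 \<noteq> 0" using T_pos by fastforce+
    moreover have "continuous_on {0..1} a" "continuous_on {0..1} b" "continuous_on {0..1} a'" "continuous_on {0..1} b'"
      unfolding a_def b_def a'_def b'_def using sL by (intro continuous_intros; simp)+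
    ultimately show ?thesis unfolding D_def unfolding T_def S_def by (intro continuous_intros) auto
  qed
  have gg: "1 - (norm (\<gamma> t))\<^sup>2 = 2 / (1 + T (a t) (b t))" if "t \<in> {0..1}" for t
  proof -
    define \<tau> where "\<tau> = T (a t) (b t)"
    have \<tau>: "\<tau> > 0" using T_pos[OF that] by (simp add: \<tau>_def)
    have "(norm (\<gamma> t))\<^sup>2 = (\<tau>\<^sup>2 - 1) / (1 + \<tau>)\<^sup>2"
      unfolding power2_norm_eq_inner \<gamma>_def using SS[of t]
      by (simp add: \<tau>_def[symmetric] power2_eq_square)
    also have "\<dots> = (\<tau> - 1) / (1 + \<tau>)"
    proof -
      have "\<tau>\<^sup>2 - 1 = (\<tau> - 1) * (1 + \<tau>)" by (simp add: power2_eq_square algebra_simps)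
      then show ?thesis using \<tau> by (simp add: power2_eq_square)
    qed
    finally show ?thesis using \<tau> by (simp add: \<tau>_def[symmetric] field_simps)
  qed
  have in_ball: "norm (\<gamma> t) < 1" if "t \<in> {0..1}" for t
  proof -
    have "1 - (norm (\<gamma> t))\<^sup>2 > 0" unfolding gg[OF that] using T_pos[OF that] by simp
    then show ?thesis by (simp add: power2_less_1_iff)
  qed
  have speed: "conf_factor (\<gamma> t) * norm (D t) = L" if "t \<in> {0..1}" for t
  proof -
    define \<tau> \<sigma> where "\<tau> = T (a t) (b t)" "\<sigma> = T (a' t) (b' t)"
    have \<tau>: "\<tau> > 0" using T_pos[OF that] by (simp add: \<tau>_\<sigma>_def)
    have c: "conf_factor (\<gamma> t) = 1 + \<tau>"
      unfolding conf_factor_def gg[OF that] using \<tau> by (simp add: \<tau>_\<sigma>_def)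
    define s where "s = 1 + \<tau>"
    have s: "s > 0" "\<tau> = s - 1" using \<tau> by (auto simp: s_def)
    have expand: "(\<alpha> *\<^sub>R X - \<beta> *\<^sub>R Y) \<bullet> (\<alpha> *\<^sub>R X - \<beta> *\<^sub>R Y)
        = \<alpha>\<^sup>2 * (X \<bullet> X) - 2 * \<alpha> * \<beta> * (Y \<bullet> X) + \<beta>\<^sup>2 * (Y \<bullet> Y)" for \<alpha> \<beta> and X Y :: "real ^ 'n"
      by (simp add: inner_diff_left inner_diff_right inner_commute power2_eq_square algebra_simps)
    have "D t \<bullet> D t = (1 / s)\<^sup>2 * (\<sigma>\<^sup>2 + L\<^sup>2) - 2 * (1 / s) * (\<sigma> / s\<^sup>2) * (\<tau> * \<sigma>) + (\<sigma> / s\<^sup>2)\<^sup>2 * (\<tau>\<^sup>2 - 1)"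
      unfolding D_def expand SS SS' S'S' \<tau>_\<sigma>_def s_def ..
    also have "\<dots> = L\<^sup>2 / s\<^sup>2"
      unfolding s(2) using s(1) by (simp add: field_simps power2_eq_square)
    also have "s = 1 + \<tau>" by (rule s_def)
    finally have "norm (D t) = L / (1 + \<tau>)"
      using L \<tau> by (simp add: norm_eq_sqrt_inner real_sqrt_divide)
    then show ?thesis using c \<tau> by simp
  qed
  have len: "hyp_length \<gamma> = L"
  proof -
    have "hyp_length \<gamma> = integral {0..1} (\<lambda>t::real. L)"
      unfolding hyp_length_def using vector_derivative_at[OF dg] in_ball speed
      by (intro integral_cong) (simp add: hyp_norm_eq)
    then show ?thesis by simp
  qed
  show ?thesis
  proof (rule that)
    show "\<gamma> C1_differentiable_on {0..1}"
      unfolding C1_differentiable_on_def using dg cD by blast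
    show "path_image \<gamma> \<subseteq> hyp_space" using in_ball by (auto simp: path_image_def hyp_space_def)
    show "pathstart \<gamma> = x" "pathfinish \<gamma> = y"
      using sL pq by (simp_all add: pathstart_def pathfinish_def \<gamma>_def a_def b_def S_def T_def)
    show "hyp_length \<gamma> = arcosh (cosh_dist y x)" using len by (simp add: L_def)
  qed
qed

lemma hyp_dist_eq_arcosh:
  fixes x y :: "real ^ 'n"
  assumes x: "norm x < 1" and y: "norm y < 1"
  shows "hyp_dist x y = arcosh (cosh_dist y x)"
proof -
  let ?A = "{\<gamma>. \<gamma> C1_differentiable_on {0..1} \<and> path_image \<gamma> \<subseteq> hyp_space \<and>
      pathstart \<gamma> = x \<and> pathfinish \<gamma> = y}"
  obtain \<gamma> where \<gamma>: "\<gamma> \<in> ?A" "hyp_length \<gamma> = arcosh (cosh_dist y x)"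
  proof -
    obtain \<gamma> where "\<gamma> C1_differentiable_on {0..1}" "path_image \<gamma> \<subseteq> hyp_space"
      "pathstart \<gamma> = x" "pathfinish \<gamma> = y" "hyp_length \<gamma> = arcosh (cosh_dist y x)"
      by (rule geodesic_exists[OF x y])
    then show ?thesis using that[of \<gamma>] by simp
  qed
  have lower: "arcosh (cosh_dist y x) \<le> hyp_length \<gamma>" if "\<gamma> \<in> ?A" for \<gamma>
  proof -
    have "arcosh (cosh_dist x y) \<le> arcosh (cosh_dist x x) + hyp_length \<gamma>"
      using arcosh_cosh_dist_le_add_length[of \<gamma> x] that x by auto
    then show ?thesis by (simp add: cosh_dist_commute[of x y] cosh_dist_def[of x x])
  qed
  show ?thesis unfolding hyp_dist_def
  proof (rule antisym)
    show "(INF \<gamma>\<in>?A. hyp_length \<gamma>) \<le> arcosh (cosh_dist y x)"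
      unfolding \<gamma>(2)[symmetric] by (rule cINF_lower[OF _ \<gamma>(1)]) (use lower in \<open>auto simp: bdd_below_def\<close>)
    show "arcosh (cosh_dist y x) \<le> (INF \<gamma>\<in>?A. hyp_length \<gamma>)"
      by (rule cINF_greatest) (use \<gamma>(1) lower in auto)
  qed
qed

text \<open>
  Instead of concatenating curves, which would create corners, the Lipschitz estimate is applied
  to the geodesic from \<open>y\<close> to \<open>x\<close>.
\<close>

lemma hyp_dist_triangle:
  fixes x y z :: "real ^ 'n"
  assumes x: "norm x < 1" and y: "norm y < 1" and z: "norm z < 1"
  shows "hyp_dist x z \<le> hyp_dist x y + hyp_dist y z"
proof -
  obtain \<gamma> where \<gamma>: "\<gamma> C1_differentiable_on {0..1}" "path_image \<gamma> \<subseteq> hyp_space"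
    "pathstart \<gamma> = y" "pathfinish \<gamma> = x" "hyp_length \<gamma> = arcosh (cosh_dist x y)"
    by (rule geodesic_exists[OF y x])
  from arcosh_cosh_dist_le_add_length[OF \<gamma>(1,2) z] show ?thesis
    unfolding \<gamma> using x y z by (simp add: hyp_dist_eq_arcosh cosh_dist_commute[of x y])
qed

section \<open>The radial partition function\<close>

lemma DERIV_zero_if_quadratic:
  fixes f :: "real \<Rightarrow> real"
  assumes "\<And>x. \<bar>f x - f a\<bar> \<le> K * (x - a)\<^sup>2"
  shows "(f has_real_derivative 0) (at a)"
proof -
  have "((\<lambda>x. (f x - f a) / (x - a)) \<longlongrightarrow> 0) (at a)"
  proof (rule Lim_null_comparison)
    have "norm ((f x - f a) / (x - a)) \<le> K * \<bar>x - a\<bar>" if "x \<noteq> a" for x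
    proof -
      have "(x - a)\<^sup>2 = \<bar>x - a\<bar> * \<bar>x - a\<bar>" by (simp add: power2_eq_square)
      then have "\<bar>f x - f a\<bar> \<le> (K * \<bar>x - a\<bar>) * \<bar>x - a\<bar>" using assms[of x] by simp
      then show ?thesis using that by (simp add: abs_divide pos_divide_le_eq)
    qed
    then show "eventually (\<lambda>x. norm ((f x - f a) / (x - a)) \<le> K * \<bar>x - a\<bar>) (at a)"
      by (auto simp: eventually_at_filter)
    show "((\<lambda>x. K * \<bar>x - a\<bar>) \<longlongrightarrow> 0) (at a)" by (auto intro!: tendsto_eq_intros)
  qed
  then show ?thesis by (simp add: has_field_derivative_iff)
qed

text \<open>
  The profile of the partition function: \<open>1\<close> up to \<open>1/2\<close>, \<open>sin\<^sup>2(\<pi> t)\<close> on \<open>[1/2, 1]\<close>, and \<open>0\<close>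
  beyond. Together with its complement it is a pair of squares \<open>sin\<^sup>2\<close> and \<open>cos\<^sup>2\<close>.
\<close>

definition sin_cut :: "real \<Rightarrow> real" where
  "sin_cut t = (sin (pi * max (1/2) (min 1 t)))\<^sup>2"

definition sin_cut' :: "real \<Rightarrow> real" where
  "sin_cut' t = pi * sin (2 * (pi * max (1/2) (min 1 t)))"

lemma sin_cut_simps [simp]:
  "t \<le> 1/2 \<Longrightarrow> sin_cut t = 1" "t \<ge> 1 \<Longrightarrow> sin_cut t = 0"
  "t \<le> 1/2 \<Longrightarrow> sin_cut' t = 0" "t \<ge> 1 \<Longrightarrow> sin_cut' t = 0"
proof -
  show "sin_cut t = 1" "sin_cut' t = 0" if "t \<le> 1/2"
  proof -
    have "max (1/2) (min 1 t) = 1/2" using that by auto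
    then show "sin_cut t = 1" "sin_cut' t = 0" unfolding sin_cut_def sin_cut'_def by simp_all
  qed
  show "sin_cut t = 0" "sin_cut' t = 0" if "t \<ge> 1"
  proof -
    have "max (1/2) (min 1 t) = 1" using that by auto
    then show "sin_cut t = 0" "sin_cut' t = 0" unfolding sin_cut_def sin_cut'_def by simp_all
  qed
qed

lemma sin_cut_bounds: "0 \<le> sin_cut t" "sin_cut t \<le> 1"
  by (auto simp: sin_cut_def abs_square_le_1)

lemma sin_cut'_nonpos: "sin_cut' t \<le> 0"
proof -
  define s where "s = max (1/2) (min 1 t)"
  have "1/2 \<le> s" "s \<le> 1" by (auto simp: s_def)
  then have "sin (2 * (pi * s) - pi) \<ge> 0" by (intro sin_ge_zero) auto
  then show ?thesis unfolding sin_cut'_def s_def[symmetric]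
    by (simp add: sin_diff mult_nonneg_nonpos)
qed

text \<open>
  On \<open>[1/2, 1]\<close> the angle whose squared sine is \<open>sin_cut t\<close> moves at speed \<open>\<pi>\<close>, which is the
  source of the localization cost \<open>\<pi>\<^sup>2 / d\<^sup>2\<close>. In this form, without division by
  \<open>sin_cut t * (1 - sin_cut t)\<close>, the identity persists where \<open>sin_cut\<close> is constant.
\<close>

lemma sin_cut'_sq: "(sin_cut' t)\<^sup>2 = 4 * pi\<^sup>2 * (sin_cut t * (1 - sin_cut t))"
proof -
  have "1 - (sin x)\<^sup>2 = (cos x)\<^sup>2" for x :: real using sin_cos_squared_add[of x] by linarith
  then show ?thesis unfolding sin_cut'_def sin_cut_def sin_double
    by (simp add: power_mult_distrib)
qed

lemma sin_cut_DERIV: "(sin_cut has_real_derivative sin_cut' t) (at t)"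
proof -
  define c where "c = (\<lambda>t::real. max (1/2) (min 1 t))"
  have cossq: "1 - (sin x)\<^sup>2 = (cos x)\<^sup>2" for x :: real using sin_cos_squared_add[of x] by linarith
  have sq: "(sin y)\<^sup>2 \<le> z" if "y\<^sup>2 \<le> z" for y z :: real
    using abs_sin_x_le_abs_x[of y] that by (simp add: abs_le_square_iff)
  consider "t < 1/2" | "t = 1/2" | "1/2 < t" "t < 1" | "t = 1" | "t > 1" by linarith
  then show ?thesis
  proof cases
    case 1
    have "((\<lambda>_. 1) has_real_derivative 0) (at t)" by simp
    then have "(sin_cut has_real_derivative 0) (at t)"
      by (rule has_field_derivative_transform_within_open[of _ _ _ "{..<1/2}"]) (use 1 in auto)
    then show ?thesis using 1 by simp
  next
    case 5
    have "((\<lambda>_. 0) has_real_derivative 0) (at t)" by simp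
    then have "(sin_cut has_real_derivative 0) (at t)"
      by (rule has_field_derivative_transform_within_open[of _ _ _ "{1<..}"]) (use 5 in auto)
    then show ?thesis using 5 by simp
  next
    case 3
    have "((\<lambda>t. (sin (pi * t))\<^sup>2) has_real_derivative pi * sin (2 * (pi * t))) (at t)"
      unfolding sin_double by (auto intro!: derivative_eq_intros)
    then have "(sin_cut has_real_derivative pi * sin (2 * (pi * t))) (at t)"
      by (rule has_field_derivative_transform_within_open[of _ _ _ "{1/2<..<1}"])
        (use 3 in \<open>auto simp: sin_cut_def\<close>)
    then show ?thesis using 3 by (simp add: sin_cut'_def)
  next
    case 2
    have "\<bar>sin_cut x - sin_cut (1/2)\<bar> \<le> pi\<^sup>2 * (x - 1/2)\<^sup>2" for x
    proof -
      have "(c x - 1/2)\<^sup>2 \<le> (x - 1/2)\<^sup>2"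
        unfolding abs_le_square_iff[symmetric] c_def by linarith
      then have "(pi * (c x - 1/2))\<^sup>2 \<le> pi\<^sup>2 * (x - 1/2)\<^sup>2" by (simp add: power_mult_distrib)
      then have "(sin (pi * (c x - 1/2)))\<^sup>2 \<le> pi\<^sup>2 * (x - 1/2)\<^sup>2" by (rule sq)
      moreover have "(sin (pi * (c x - 1/2)))\<^sup>2 = (cos (pi * c x))\<^sup>2"
        by (simp add: right_diff_distrib sin_diff)
      moreover have "sin_cut x = 1 - (cos (pi * c x))\<^sup>2"
        using cossq[of "pi * c x"] by (simp add: sin_cut_def c_def)
      ultimately show ?thesis by simp
    qed
    from DERIV_zero_if_quadratic[OF this] show ?thesis unfolding 2 by simp
  next
    case 4
    have "\<bar>sin_cut x - sin_cut 1\<bar> \<le> pi\<^sup>2 * (x - 1)\<^sup>2" for x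
    proof -
      have "(c x - 1)\<^sup>2 \<le> (x - 1)\<^sup>2"
        unfolding abs_le_square_iff[symmetric] c_def by linarith
      then have "(pi * (c x - 1))\<^sup>2 \<le> pi\<^sup>2 * (x - 1)\<^sup>2" by (simp add: power_mult_distrib)
      then have "(sin (pi * (c x - 1)))\<^sup>2 \<le> pi\<^sup>2 * (x - 1)\<^sup>2" by (rule sq)
      moreover have "(sin (pi * (c x - 1)))\<^sup>2 = (sin (pi * c x))\<^sup>2"
        by (simp add: right_diff_distrib sin_diff)
      ultimately show ?thesis by (simp add: sin_cut_def c_def)
    qed
    from DERIV_zero_if_quadratic[OF this] show ?thesis using 4 by simp
  qed
qed

lemma continuous_on_sin_cut' [continuous_intros]:
  fixes f :: "real \<Rightarrow> real"
  shows "continuous_on A f \<Longrightarrow> continuous_on A (\<lambda>x. sin_cut' (f x))"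
  unfolding sin_cut'_def
  by (intro continuous_on_sin continuous_on_mult continuous_on_max
      continuous_on_min continuous_on_const; assumption)

text \<open>
  At distance \<open>r = t d\<close> from a pole its field has weight \<open>sin_cut t\<close>, so that the fraction
  \<open>1 - sin_cut t\<close> of the potential \<open>1 / r\<^sup>2\<close> is left uncovered. The bound says that this costs at
  most as much as two poles at distance \<open>d\<close>; together with the other \<open>M - 1\<close> poles it explains the
  factor \<open>M + 1\<close> in the threshold equation.
\<close>

lemma one_minus_sin_cut_le: "t > 0 \<Longrightarrow> 1 - sin_cut t \<le> 2 * t\<^sup>2"
proof -
  assume "t > 0"
  consider "t \<le> 1/2" | "1/2 < t" "t \<le> 3/4" | "t \<ge> 3/4" by linarith
  then show ?thesis
  proof cases
    case 1
    then show ?thesis by simp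
  next
    case 2
    have "sin (pi / 4) \<le> sin (pi - pi * t)"
      using 2 pi_gt_zero by (intro sin_monotone_2pi_le) (auto simp: field_simps)
    then have "sin (pi / 4) \<le> sin (pi * t)" by (simp add: sin_diff)
    then have "(sin (pi / 4))\<^sup>2 \<le> (sin (pi * t))\<^sup>2" by (intro power_mono) (auto simp: sin_45)
    moreover have "(sin (pi / 4))\<^sup>2 = 1/2" by (simp add: sin_45 power_divide)
    moreover have "sin_cut t = (sin (pi * t))\<^sup>2" using 2 by (simp add: sin_cut_def)
    moreover have "(1/2)\<^sup>2 \<le> t\<^sup>2" using 2 by (intro power_mono) auto
    ultimately show ?thesis by (simp add: power2_eq_square)
  next
    case 3
    then have "(3/4)\<^sup>2 \<le> t\<^sup>2" by (intro power_mono) auto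
    moreover have "(3/4)\<^sup>2 = (9/16::real)" by (simp add: power2_eq_square)
    ultimately show ?thesis using sin_cut_bounds[of t] by linarith
  qed
qed

text \<open>
  The cut-off \<open>sin_cut (r/d)\<close> as a function of \<open>c = cosh r\<close>. The value \<open>1\<close> for \<open>c \<le> 1\<close> continues
  it to a continuously differentiable function on the real line, so that its composition with
  \<open>cosh_dist y\<close> is differentiable at \<open>y\<close>, although \<open>arcosh\<close> is not differentiable at \<open>1\<close>.
\<close>

definition ball_cut :: "real \<Rightarrow> real \<Rightarrow> real" where
  "ball_cut d c = (if c \<le> 1 then 1 else sin_cut (arcosh c / d))"

definition ball_cut' :: "real \<Rightarrow> real \<Rightarrow> real" where
  "ball_cut' d c = (if c \<le> 1 then 0 else sin_cut' (arcosh c / d) / (d * sqrt (c\<^sup>2 - 1)))"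

lemma arcosh_le_iff: "1 \<le> (c::real) \<Longrightarrow> 0 \<le> r \<Longrightarrow> arcosh c \<le> r \<longleftrightarrow> c \<le> cosh r"
  by (metis arcosh_nonneg_real cosh_arcosh_real cosh_real_nonneg_le_iff)

lemma arcosh_less_iff: "1 \<le> (c::real) \<Longrightarrow> 0 \<le> r \<Longrightarrow> arcosh c < r \<longleftrightarrow> c < cosh r"
  by (metis arcosh_nonneg_real cosh_arcosh_real cosh_real_nonneg_less_iff)

lemma ball_cut_bounds: "0 \<le> ball_cut d c" "ball_cut d c \<le> 1"
  using sin_cut_bounds by (auto simp: ball_cut_def)

lemma ball_cut_eq_1:
  assumes "d > 0" "c \<le> cosh (d / 2)"
  shows "ball_cut d c = 1" "ball_cut' d c = 0"
  using assms arcosh_le_iff[of c "d / 2"] by (auto simp: ball_cut_def ball_cut'_def field_simps)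

lemma ball_cut_eq_0:
  assumes "d > 0" "c \<ge> cosh d"
  shows "ball_cut d c = 0" "ball_cut' d c = 0"
proof -
  have "c > 1" using cosh_real_strict_mono[of 0 d] assms by simp
  moreover have "arcosh c \<ge> d" using arcosh_less_iff[of c d] assms \<open>c > 1\<close> by fastforce
  ultimately show "ball_cut d c = 0" "ball_cut' d c = 0"
    using assms by (auto simp: ball_cut_def ball_cut'_def)
qed

lemma ball_cut'_nonpos: "d > 0 \<Longrightarrow> ball_cut' d c \<le> 0"
  using sin_cut'_nonpos by (auto simp: ball_cut'_def intro!: divide_nonpos_nonneg)

lemma ball_cut'_sq:
  assumes "d > 0" "c \<ge> 1"
  shows "(ball_cut' d c)\<^sup>2 * (c\<^sup>2 - 1) = 4 * (pi\<^sup>2 / d\<^sup>2) * (ball_cut d c * (1 - ball_cut d c))"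
proof (cases "c = 1")
  case False
  then have c: "c > 1" using assms by simp
  then have p: "c\<^sup>2 - 1 > 0" by (simp add: one_less_power)
  have "(ball_cut' d c)\<^sup>2 = (sin_cut' (arcosh c / d))\<^sup>2 / (d\<^sup>2 * (c\<^sup>2 - 1))"
    using c p by (simp add: ball_cut'_def power_divide power_mult_distrib)
  then have "(ball_cut' d c)\<^sup>2 * (c\<^sup>2 - 1) = (sin_cut' (arcosh c / d))\<^sup>2 / d\<^sup>2"
    using p mult_divide_mult_cancel_right[of "c\<^sup>2 - 1"] by auto
  then show ?thesis using c by (simp add: sin_cut'_sq ball_cut_def)
qed (simp add: ball_cut_def)

lemma ball_cut_DERIV:
  assumes "d > 0"
  shows "(ball_cut d has_real_derivative ball_cut' d c) (at c)"
proof (cases "c > 1")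
  case True
  then have "c\<^sup>2 > 1" by (simp add: one_less_power)
  then have "((\<lambda>c. sin_cut (arcosh c / d)) has_real_derivative ball_cut' d c) (at c)"
    using True assms unfolding ball_cut'_def
    by (auto intro!: DERIV_chain2[OF sin_cut_DERIV, THEN DERIV_cong] derivative_eq_intros simp: field_simps)
  then show ?thesis
    by (rule has_field_derivative_transform_within_open[of _ _ _ "{1<..}"])
      (use True in \<open>auto simp: ball_cut_def\<close>)
next
  case False
  then have c: "c < cosh (d / 2)" using cosh_real_strict_mono[of 0 "d/2"] assms by simp
  have "((\<lambda>_. 1) has_real_derivative 0) (at c)" by simp
  then have "(ball_cut d has_real_derivative 0) (at c)"
    by (rule has_field_derivative_transform_within_open[of _ _ _ "{..<cosh (d/2)}"])
      (use c assms ball_cut_eq_1 in auto)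
  then show ?thesis using ball_cut_eq_1[of d c] c assms by simp
qed

text \<open>
  The derivatives of the profiles vanish near \<open>c = 1\<close>, so continuity has to be checked only for
  \<open>c > 1\<close>, where \<open>arcosh\<close> is smooth.
\<close>

lemma continuous_on_if_zero_below:
  fixes f :: "real \<Rightarrow> real"
  assumes "a > 1" "continuous_on {1<..} f" "\<And>c. c < a \<Longrightarrow> f c = 0"
  shows "continuous_on UNIV f"
proof -
  have "continuous_on {..<a} f"
    by (rule continuous_on_eq[OF continuous_on_const[of _ 0]]) (use assms in auto)
  then have "continuous_on ({..<a} \<union> {1<..}) f" using assms by (intro continuous_on_open_Un) auto
  moreover have "{..<a} \<union> {1<..} = UNIV" using assms by auto
  ultimately show ?thesis by simp
qed

lemma continuous_on_ball_cut':
  assumes "d > 0" shows "continuous_on UNIV (ball_cut' d)"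
proof (rule continuous_on_if_zero_below[of "cosh (d/2)"])
  show "cosh (d/2) > 1" using cosh_real_strict_mono[of 0 "d/2"] assms by simp
  have "continuous_on {1<..} (\<lambda>c. sin_cut' (arcosh c / d) / (d * sqrt (c\<^sup>2 - 1)))"
  proof (intro continuous_intros)
    show "\<forall>x\<in>{1<..}. d * sqrt (x\<^sup>2 - 1) \<noteq> 0"
      using assms by (auto simp: power2_eq_1_iff)
  qed (use assms in auto)
  then show "continuous_on {1<..} (ball_cut' d)"
    by (rule continuous_on_eq) (simp add: ball_cut'_def)
qed (use ball_cut_eq_1 assms in auto)

section \<open>The one-pole field\<close>

text \<open>
  With \<open>c = cosh r\<close> this is \<open>-\<phi>'(r) / (\<phi>(r) sinh r)\<close> for
  \<open>\<phi>(r) = r\<^bsup>(N-2)/2\<^esup> (sinh r)\<^bsup>-(N-2)\<^esup>\<close>: the coefficient of \<open>\<nabla>c\<close> in the field \<open>-\<nabla>\<phi>/\<phi>\<close>.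
\<close>

definition pole_slope :: "real \<Rightarrow> real \<Rightarrow> real" where
  "pole_slope N c = (N - 2) * (c / sqrt (c\<^sup>2 - 1) - 1 / (2 * arcosh c)) / sqrt (c\<^sup>2 - 1)"

definition pole_slope' :: "real \<Rightarrow> real \<Rightarrow> real" where
  "pole_slope' N c = (N - 2) * ((1 + arcosh c * (c / sqrt (c\<^sup>2 - 1))) / (2 * (arcosh c)\<^sup>2)
     - (2 * (c / sqrt (c\<^sup>2 - 1))\<^sup>2 - 1)) / (c\<^sup>2 - 1)"

definition hardy_potential :: "real \<Rightarrow> real \<Rightarrow> real" where
  "hardy_potential N r = (N - 2)\<^sup>2 / 4 * (1 / r\<^sup>2) + (N - 2) * (N - 3) / 2 * hardy_g r"

lemma sq_gt_1: "c > 1 \<Longrightarrow> c\<^sup>2 > (1::real)"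
  by (simp add: one_less_power)

lemma sinh_less_mult_cosh:
  assumes "r > 0" shows "sinh r < r * cosh (r::real)"
proof -
  have "0 * cosh 0 - sinh 0 < r * cosh r - sinh r"
  proof (rule DERIV_pos_imp_increasing_open[OF assms])
    fix x :: real assume "0 < x"
    have "((\<lambda>x. x * cosh x - sinh x) has_real_derivative x * sinh x) (at x)"
      by (auto intro!: derivative_eq_intros)
    then show "\<exists>y. ((\<lambda>x. x * cosh x - sinh x) has_real_derivative y) (at x) \<and> y > 0"
      using \<open>0 < x\<close> by (intro exI[of _ "x * sinh x"] conjI) auto
  qed (intro continuous_intros)
  then show ?thesis by simp
qed

lemma hardy_g_nonneg: "hardy_g r \<ge> 0" if "r > 0"
  using sinh_less_mult_cosh[OF that] that by (simp add: hardy_g_def field_simps)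

lemma hardy_potential_nonneg: "r > 0 \<Longrightarrow> N \<ge> 3 \<Longrightarrow> hardy_potential N r \<ge> 0"
  unfolding hardy_potential_def using hardy_g_nonneg by (intro add_nonneg_nonneg mult_nonneg_nonneg) auto

lemma pole_slope_nonneg:
  assumes "c > 1" "N \<ge> 2"
  shows "pole_slope N c \<ge> 0"
proof -
  have r: "arcosh c > 0" using assms by simp
  have "sqrt (c\<^sup>2 - 1) < arcosh c * c"
    using sinh_less_mult_cosh[OF r] assms by (simp add: sinh_arcosh_real)
  moreover have "arcosh c * c \<ge> 0" using r assms by simp
  ultimately have "sqrt (c\<^sup>2 - 1) \<le> 2 * arcosh c * c" by linarith
  then have "1 / (2 * arcosh c) \<le> c / sqrt (c\<^sup>2 - 1)"
    using r sq_gt_1[OF assms(1)] by (simp add: field_simps)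
  then show ?thesis unfolding pole_slope_def using assms sq_gt_1[OF assms(1)] by auto
qed

text \<open>
  For a radial field \<open>X = a(c) \<nabla>c\<close> the left-hand side is \<open>div X - |X|\<^sup>2\<close>, by \<open>|\<nabla>c|\<^sup>2 = c\<^sup>2 - 1\<close> and
  \<open>\<Delta>c = N c\<close>. In terms of \<open>k = coth r\<close> and \<open>w = 1/r\<close> the claim is a polynomial identity.
\<close>

lemma pole_slope_riccati:
  assumes "c > 1"
  shows "pole_slope' N c * (c\<^sup>2 - 1) + N * c * pole_slope N c - (pole_slope N c)\<^sup>2 * (c\<^sup>2 - 1)
    = hardy_potential N (arcosh c) + (N - 2)"
proof -
  define s k w where "s = sqrt (c\<^sup>2 - 1)" "k = c / s" "w = 1 / arcosh c"
  have s: "s > 0" "c\<^sup>2 - 1 = s\<^sup>2" using sq_gt_1[OF assms] by (auto simp: s_k_w_def)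
  have r: "arcosh c > 0" using assms by simp
  have 1: "pole_slope' N c * (c\<^sup>2 - 1) = (N - 2) * ((w\<^sup>2 + k * w) / 2 - (2 * k\<^sup>2 - 1))"
    using s r unfolding pole_slope'_def by (simp add: s_k_w_def(1)[symmetric] s_k_w_def(2,3) field_simps power2_eq_square)
  have 2: "N * c * pole_slope N c = N * k * (N - 2) * (k - w / 2)"
    using s r unfolding pole_slope_def by (simp add: s_k_w_def(1)[symmetric] s_k_w_def(2,3))
  have 3: "(pole_slope N c)\<^sup>2 * (c\<^sup>2 - 1) = (N - 2)\<^sup>2 * (k - w / 2)\<^sup>2"
    using s r unfolding pole_slope_def by (simp add: s_k_w_def(1)[symmetric] s_k_w_def(2,3) power_mult_distrib power_divide mult.commute)
  have g: "hardy_g (arcosh c) = k * w - w\<^sup>2"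
    using assms r unfolding hardy_g_def
    by (simp add: sinh_arcosh_real s_k_w_def field_simps power2_eq_square)
  have w: "1 / (arcosh c)\<^sup>2 = w\<^sup>2" by (simp add: s_k_w_def power_divide)
  show ?thesis unfolding 1 2 3 hardy_potential_def g w
    by (simp add: field_simps power2_eq_square)
qed

lemma pole_slope_DERIV:
  assumes "c > 1"
  shows "(pole_slope N has_real_derivative pole_slope' N c) (at c)"
proof -
  define s where "s = sqrt (c\<^sup>2 - 1)"
  have s: "s > 0" "c\<^sup>2 - 1 = s\<^sup>2" using sq_gt_1[OF assms] by (auto simp: s_def)
  have r: "arcosh c > 0" using assms by simp
  have ds: "((\<lambda>c. sqrt (c\<^sup>2 - 1)) has_real_derivative c / s) (at c)"
    using sq_gt_1[OF assms] by (auto intro!: derivative_eq_intros simp: s_def field_simps)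
  have dr: "(arcosh has_real_derivative 1 / s) (at c)"
    using arcosh_real_has_field_derivative[OF assms] by (simp add: s_def)
  have c2: "c\<^sup>2 = 1 + s\<^sup>2" using s(2) by linarith
  have "(pole_slope N has_real_derivative
      (N - 2) * (((1 * s - c * (c / s)) / (s * s) - (0 * (2 * arcosh c) - 1 * (2 * (1 / s))) / ((2 * arcosh c) * (2 * arcosh c))) * s
       - (c / s - 1 / (2 * arcosh c)) * (c / s)) / (s * s)) (at c)"
    unfolding pole_slope_def[abs_def]
    using s r assms by (auto intro!: derivative_eq_intros ds dr simp: s_def[symmetric])
      (simp add: field_simps)
  moreover have "(N - 2) * (((1 * s - c * (c / s)) / (s * s) - (0 * (2 * arcosh c) - 1 * (2 * (1 / s))) / ((2 * arcosh c) * (2 * arcosh c))) * s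
       - (c / s - 1 / (2 * arcosh c)) * (c / s)) / (s * s) = pole_slope' N c"
  proof -
    define k w where "k = c / s" "w = 1 / arcosh c"
    have "c = k * s" "arcosh c = 1 / w" "w > 0" using s r by (auto simp: k_w_def)
    have k1: "k\<^sup>2 = 1 + 1 / s\<^sup>2" using s c2 by (simp add: k_w_def power_divide field_simps)
    have a: "pole_slope' N c = (N - 2) * ((w\<^sup>2 + k * w) / 2 - (2 * k\<^sup>2 - 1)) / s\<^sup>2"
      using s r unfolding pole_slope'_def by (simp add: s_def[symmetric] k_w_def field_simps power2_eq_square)
    have b: "((1 * s - c * (c / s)) / (s * s) - (0 * (2 * arcosh c) - 1 * (2 * (1 / s))) / ((2 * arcosh c) * (2 * arcosh c))) * s
       - (c / s - 1 / (2 * arcosh c)) * (c / s) = (1 - k\<^sup>2) + w\<^sup>2 / 2 - (k - w / 2) * k"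
      using s r by (simp add: k_w_def field_simps power2_eq_square)
    have "(1 - k\<^sup>2) + w\<^sup>2 / 2 - (k - w / 2) * k = (w\<^sup>2 + k * w) / 2 - (2 * k\<^sup>2 - 1)"
      by (simp add: power2_eq_square field_simps)
    then show ?thesis unfolding a b by (simp add: power2_eq_square[of s])
  qed
  ultimately show ?thesis by simp
qed

lemma continuous_on_pole_slope': "continuous_on {1<..} (pole_slope' N)"
proof -
  have "\<forall>c\<in>{1<..}. sqrt (c\<^sup>2 - 1) \<noteq> 0 \<and> c\<^sup>2 - 1 \<noteq> (0::real) \<and> 2 * (arcosh c)\<^sup>2 \<noteq> 0"
    using sq_gt_1 by (auto simp: less_le)
  then show ?thesis unfolding pole_slope'_def by (intro continuous_intros) auto
qed

text \<open>
  The coefficient of the one-pole field, switched off for \<open>c \<le> cosh (e/2)\<close> and unchanged for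
  \<open>c \<ge> cosh e\<close>.
\<close>

definition cut_slope :: "real \<Rightarrow> real \<Rightarrow> real \<Rightarrow> real" where
  "cut_slope N e c = (if c \<le> 1 then 0 else (1 - ball_cut e c) * pole_slope N c)"

definition cut_slope' :: "real \<Rightarrow> real \<Rightarrow> real \<Rightarrow> real" where
  "cut_slope' N e c = (if c \<le> 1 then 0
     else (1 - ball_cut e c) * pole_slope' N c - ball_cut' e c * pole_slope N c)"

lemma cut_slope_eq_0:
  assumes "e > 0" "c \<le> cosh (e / 2)"
  shows "cut_slope N e c = 0" "cut_slope' N e c = 0"
  using ball_cut_eq_1[OF assms] by (auto simp: cut_slope_def cut_slope'_def)

lemma cut_slope_DERIV:
  assumes "e > 0"
  shows "(cut_slope N e has_real_derivative cut_slope' N e c) (at c)"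
proof (cases "c > 1")
  case True
  have "((\<lambda>c. (1 - ball_cut e c) * pole_slope N c) has_real_derivative cut_slope' N e c) (at c)"
    using True unfolding cut_slope'_def
    by (auto intro!: derivative_eq_intros ball_cut_DERIV[OF assms] pole_slope_DERIV[OF True])
  then show ?thesis
    by (rule has_field_derivative_transform_within_open[of _ _ _ "{1<..}"])
      (use True in \<open>auto simp: cut_slope_def\<close>)
next
  case False
  then have c: "c < cosh (e / 2)" using cosh_real_strict_mono[of 0 "e/2"] assms by simp
  have "((\<lambda>_. 0) has_real_derivative 0) (at c)" by simp
  then have "(cut_slope N e has_real_derivative 0) (at c)"
    by (rule has_field_derivative_transform_within_open[of _ _ _ "{..<cosh (e/2)}"])
      (use c assms cut_slope_eq_0 in auto)
  then show ?thesis using cut_slope_eq_0[of e c] c assms by simp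
qed

lemma continuous_on_cut_slope':
  assumes "e > 0" shows "continuous_on UNIV (cut_slope' N e)"
proof (rule continuous_on_if_zero_below[of "cosh (e/2)"])
  show "cosh (e/2) > 1" using cosh_real_strict_mono[of 0 "e/2"] assms by simp
  have "continuous_on {1<..} (ball_cut e)" "continuous_on {1<..} (pole_slope N)"
    using DERIV_continuous_on has_field_derivative_at_within ball_cut_DERIV[OF assms] pole_slope_DERIV
    by (meson greaterThan_iff)+
  then have "continuous_on {1<..} (\<lambda>c. (1 - ball_cut e c) * pole_slope' N c - ball_cut' e c * pole_slope N c)"
    by (intro continuous_intros continuous_on_pole_slope'
        continuous_on_subset[OF continuous_on_ball_cut'[OF assms]]) auto
  then show "continuous_on {1<..} (cut_slope' N e)"
    by (rule continuous_on_eq) (simp add: cut_slope'_def)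
qed (use cut_slope_eq_0 assms in auto)

text \<open>
  For \<open>h = 1 - ball_cut e c\<close> and the one-pole field \<open>X\<close>, the expression
  \<open>div (h X) - |h X|\<^sup>2\<close> exceeds \<open>h (div X - |X|\<^sup>2)\<close> by \<open>\<nabla>h \<cdot> X + h (1 - h) |X|\<^sup>2\<close>, and both terms are
  nonnegative because \<open>h\<close> increases in the direction of \<open>X\<close> and lies between \<open>0\<close> and \<open>1\<close>.
\<close>

lemma cut_slope_riccati:
  assumes "c \<ge> 1" "e > 0" "N \<ge> 3"
  shows "cut_slope' N e c * (c\<^sup>2 - 1) + N * c * cut_slope N e c - (cut_slope N e c)\<^sup>2 * (c\<^sup>2 - 1)
    \<ge> (if c \<ge> cosh e then hardy_potential N (arcosh c) + (N - 2) else 0)"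
proof (cases "c = 1")
  case True
  then show ?thesis using cosh_real_strict_mono[of 0 e] assms by (simp add: cut_slope_def)
next
  case False
  then have c: "c > 1" using assms by simp
  define h a a' k where "h = 1 - ball_cut e c" "a = pole_slope N c" "a' = pole_slope' N c" "k = ball_cut' e c"
  have h: "0 \<le> h" "h \<le> 1" using ball_cut_bounds[of e c] by (auto simp: h_a_a'_k_def)
  have a: "a \<ge> 0" using pole_slope_nonneg[OF c] assms by (simp add: h_a_a'_k_def)
  have k: "k \<le> 0" using ball_cut'_nonpos[of e] assms by (simp add: h_a_a'_k_def)
  have c2: "c\<^sup>2 - 1 > 0" using sq_gt_1[OF c] by simp
  have V: "hardy_potential N (arcosh c) + (N - 2) \<ge> 0"
    using hardy_potential_nonneg[of "arcosh c" N] c assms by simp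
  have R: "a' * (c\<^sup>2 - 1) + N * c * a - a\<^sup>2 * (c\<^sup>2 - 1) = hardy_potential N (arcosh c) + (N - 2)"
    unfolding h_a_a'_k_def by (rule pole_slope_riccati[OF c])
  have "cut_slope' N e c * (c\<^sup>2 - 1) + N * c * cut_slope N e c - (cut_slope N e c)\<^sup>2 * (c\<^sup>2 - 1)
    = (h * a' - k * a) * (c\<^sup>2 - 1) + N * c * (h * a) - (h * a)\<^sup>2 * (c\<^sup>2 - 1)"
    using c by (simp add: cut_slope_def cut_slope'_def h_a_a'_k_def)
  also have "\<dots> = h * (a' * (c\<^sup>2 - 1) + N * c * a - a\<^sup>2 * (c\<^sup>2 - 1)) + (- k) * a * (c\<^sup>2 - 1)
       + h * (1 - h) * a\<^sup>2 * (c\<^sup>2 - 1)"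
    by (simp add: algebra_simps power2_eq_square)
  also have "\<dots> \<ge> h * (a' * (c\<^sup>2 - 1) + N * c * a - a\<^sup>2 * (c\<^sup>2 - 1))"
  proof -
    have "(- k) * a * (c\<^sup>2 - 1) \<ge> 0" "h * (1 - h) * a\<^sup>2 * (c\<^sup>2 - 1) \<ge> 0"
      using h a k c2 by (intro mult_nonneg_nonneg; simp)+
    then show ?thesis by linarith
  qed
  finally have *: "cut_slope' N e c * (c\<^sup>2 - 1) + N * c * cut_slope N e c - (cut_slope N e c)\<^sup>2 * (c\<^sup>2 - 1)
    \<ge> h * (hardy_potential N (arcosh c) + (N - 2))" unfolding R .
  show ?thesis
  proof (cases "c \<ge> cosh e")
    case True
    then have "h = 1" using ball_cut_eq_0[of e c] assms by (simp add: h_a_a'_k_def)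
    then show ?thesis using * True by simp
  next
    case False
    then show ?thesis using * mult_nonneg_nonneg[OF h(1) V] by simp
  qed
qed

section \<open>Localization and the threshold distance\<close>

text \<open>
  Completing the square. Here \<open>m\<close> is the value of the partition function, \<open>k v\<close> its gradient,
  and \<open>z\<close> the difference of the two fields that are glued.
\<close>

lemma localization_square:
  fixes v z :: "'a::real_inner"
  assumes m: "0 \<le> m" "m \<le> 1" and K: "K \<ge> 0" and k: "k\<^sup>2 * (v \<bullet> v) \<le> 4 * K * (m * (1 - m))"
  shows "k * (v \<bullet> z) + m * (1 - m) * (z \<bullet> z) \<ge> - K"
proof (cases "m * (1 - m) = 0")
  case True
  have "k\<^sup>2 * (v \<bullet> v) \<ge> 0" by simp
  moreover have "4 * K * (m * (1 - m)) = 0" using True by simp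
  ultimately have "k\<^sup>2 * (v \<bullet> v) = 0" using k by linarith
  then have kv: "k * (v \<bullet> z) = 0" by auto
  show ?thesis unfolding True kv using K by simp
next
  case False
  define \<mu> where "\<mu> = m * (1 - m)"
  have \<mu>: "\<mu> > 0" using False m by (simp add: \<mu>_def less_le)
  have "0 \<le> \<mu> * ((z + (k / (2 * \<mu>)) *\<^sub>R v) \<bullet> (z + (k / (2 * \<mu>)) *\<^sub>R v))"
    using \<mu> by simp
  also have "\<dots> = \<mu> * (z \<bullet> z) + k * (v \<bullet> z) + k\<^sup>2 * (v \<bullet> v) / (4 * \<mu>)"
    using \<mu> by (simp add: inner_add_left inner_add_right inner_commute field_simps power2_eq_square)
  also have "k\<^sup>2 * (v \<bullet> v) / (4 * \<mu>) \<le> K"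
    using k \<mu> by (simp add: \<mu>_def[symmetric] pos_divide_le_eq mult_ac)
  finally show ?thesis unfolding \<mu>_def by simp
qed

text \<open>
  The pointwise inequality for one pole and the background. Here \<open>p\<close> is the gradient of \<open>u\<close>,
  \<open>v\<close> and \<open>w\<close> are the gradients of the hyperbolic cosines \<open>c\<close> and \<open>c0\<close> of the distances from the
  pole and from the centre, and \<open>m\<close>, \<open>b\<close> are the values of the partition function and of the slope
  at \<open>c\<close>, with derivatives \<open>m'\<close>, \<open>b'\<close>. Multiplied by \<open>q\<^bsup>N-2\<^esup>\<close>, the left-hand side is
  \<open>q\<^bsup>N-2\<^esup> |\<nabla>u|\<^sup>2\<close> plus the divergence of \<open>u\<^sup>2 q\<^bsup>N-2\<^esup> a\<close>, for the glued field
  \<open>a = m b v + (1 - m) w / c0\<close>. The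
  convexity defect \<open>m (1 - m) |z|\<^sup>2\<close> of the square, where \<open>z = b v - w / c0\<close>, absorbs the gradient
  of \<open>m\<close>.
\<close>

lemma localized_field_ineq:
  fixes p v w :: "'a::real_inner"
  assumes m: "0 \<le> m" "m \<le> 1" and K: "K \<ge> 0" and c0: "c0 \<ge> 1"
    and vv: "v \<bullet> v = q\<^sup>2 * (c\<^sup>2 - 1)" and ww: "w \<bullet> w = q\<^sup>2 * (c0\<^sup>2 - 1)"
    and m': "m'\<^sup>2 * (c\<^sup>2 - 1) \<le> 4 * K * (m * (1 - m))"
    and R: "R \<le> b' * (c\<^sup>2 - 1) + N * c * b - b\<^sup>2 * (c\<^sup>2 - 1)"
  shows "p \<bullet> p + 2 * u * (m * b * (p \<bullet> v) + (1 - m) * (p \<bullet> w) / c0)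
      + u\<^sup>2 * ((m' * b + m * b') * (v \<bullet> v) - m' * (v \<bullet> w) / c0 - (1 - m) * (w \<bullet> w) / c0\<^sup>2)
      + u\<^sup>2 * N * q\<^sup>2 * (m * b * c + (1 - m))
    \<ge> u\<^sup>2 * q\<^sup>2 * (m * R + (1 - m) * (N - 2) - K)"
proof -
  define z where "z = b *\<^sub>R v - (1 / c0) *\<^sub>R w"
  define a where "a = (m * b) *\<^sub>R v + ((1 - m) / c0) *\<^sub>R w"
  have aa: "a \<bullet> a = m * b\<^sup>2 * (v \<bullet> v) + (1 - m) * (w \<bullet> w) / c0\<^sup>2 - m * (1 - m) * (z \<bullet> z)"
    unfolding a_def z_def using c0
    by (simp add: inner_add_left inner_add_right inner_diff_left inner_diff_right inner_commute
        field_simps power2_eq_square)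
  have pa: "p \<bullet> a = m * b * (p \<bullet> v) + (1 - m) * (p \<bullet> w) / c0"
    by (simp add: a_def inner_add_right)
  have "0 \<le> (p + u *\<^sub>R a) \<bullet> (p + u *\<^sub>R a)" by simp
  also have "\<dots> = p \<bullet> p + 2 * u * (p \<bullet> a) + u\<^sup>2 * (a \<bullet> a)"
    by (simp add: inner_add_left inner_add_right inner_commute field_simps power2_eq_square)
  finally have 1: "p \<bullet> p + 2 * u * (p \<bullet> a) \<ge> - (u\<^sup>2 * (a \<bullet> a))" by simp
  have "m'\<^sup>2 * (v \<bullet> v) \<le> 4 * (K * q\<^sup>2) * (m * (1 - m))"
    using mult_left_mono[OF m', of "q\<^sup>2"] by (simp add: vv algebra_simps)
  then have 2: "m' * (v \<bullet> z) + m * (1 - m) * (z \<bullet> z) \<ge> - (K * q\<^sup>2)"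
    using localization_square[OF m, of "K * q\<^sup>2" m' v z] K by simp
  have vz: "v \<bullet> z = b * (v \<bullet> v) - (v \<bullet> w) / c0"
    by (simp add: z_def inner_diff_right)
  \<comment> \<open>The background field satisfies \<open>div - |.|\<^sup>2 = N - 2 + 2 / c0\<^sup>2\<close>.\<close>
  have 3: "(1 - m) * (N - 2) \<le> (1 - m) * (N - 2 * ((c0\<^sup>2 - 1) / c0\<^sup>2))"
  proof -
    have "(c0\<^sup>2 - 1) / c0\<^sup>2 \<le> 1" using c0 by (simp add: field_simps)
    then have "N - 2 \<le> N - 2 * ((c0\<^sup>2 - 1) / c0\<^sup>2)" by linarith
    then show ?thesis using m by (intro mult_left_mono) auto
  qed
  have 4: "m * R \<le> m * (b' * (c\<^sup>2 - 1) + N * c * b - b\<^sup>2 * (c\<^sup>2 - 1))"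
    using R m by (intro mult_left_mono) auto
  have "u\<^sup>2 * q\<^sup>2 * (m * R + (1 - m) * (N - 2) - K)
     \<le> u\<^sup>2 * q\<^sup>2 * (m * (b' * (c\<^sup>2 - 1) + N * c * b - b\<^sup>2 * (c\<^sup>2 - 1))
        + (1 - m) * (N - 2 * ((c0\<^sup>2 - 1) / c0\<^sup>2)) - K)"
    using 3 4 by (intro mult_left_mono) auto
  also have "\<dots> = u\<^sup>2 * (m * (b' * (v \<bullet> v) + N * q\<^sup>2 * c * b - b\<^sup>2 * (v \<bullet> v))
        + (1 - m) * (N * q\<^sup>2 - 2 * (w \<bullet> w) / c0\<^sup>2) + - (K * q\<^sup>2))"
    by (simp add: vv ww algebra_simps)
  also have "\<dots> \<le> u\<^sup>2 * (m * (b' * (v \<bullet> v) + N * q\<^sup>2 * c * b - b\<^sup>2 * (v \<bullet> v))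
        + (1 - m) * (N * q\<^sup>2 - 2 * (w \<bullet> w) / c0\<^sup>2) + (m' * (v \<bullet> z) + m * (1 - m) * (z \<bullet> z)))"
    using 2 by (intro mult_left_mono) auto
  also have "\<dots> = - (u\<^sup>2 * (a \<bullet> a))
      + u\<^sup>2 * ((m' * b + m * b') * (v \<bullet> v) - m' * (v \<bullet> w) / c0 - (1 - m) * (w \<bullet> w) / c0\<^sup>2)
      + u\<^sup>2 * N * q\<^sup>2 * (m * b * c + (1 - m))"
    unfolding aa vz by (simp add: algebra_simps add_divide_distrib diff_divide_distrib)
  finally show ?thesis using 1 unfolding pa by linarith
qed

text \<open>
  The right-hand side is what the glued field delivers at a point that is far from all poles
  except possibly \<open>k\<close>. The deficit consists of the potentials of the poles \<open>j \<noteq> k\<close>, at distance at least \<open>d\<close>, of the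
  fraction \<open>1 - m\<close> of the potential of \<open>k\<close>, which matters only for \<open>r k > d/2\<close>, and of the
  localization cost. They are bounded by \<open>card I - 1\<close> and \<open>2\<close> times the bracket in the assumption, and by
  \<open>\<pi>\<^sup>2 / d\<^sup>2\<close>.
\<close>

lemma hardy_potential_sum_le:
  fixes r :: "'i \<Rightarrow> real"
  assumes N: "N \<ge> 3" and d: "d > 0"
    and dbar: "pi\<^sup>2 / d\<^sup>2 + (real (card I) + 1) *
      ((N - 2)\<^sup>2 / 4 * (1 / d\<^sup>2) + (N - 3) * (N - 2) / 2 * hardy_g (d / 2)) \<le> N - 2"
    and I: "finite I" "k \<in> I" and far: "\<And>j. j \<in> I \<Longrightarrow> j \<noteq> k \<Longrightarrow> r j \<ge> d" and rk: "r k > 0"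
  defines "m \<equiv> sin_cut (r k / d)"
  shows "(\<Sum>j\<in>I. hardy_potential N (r j))
    \<le> m * (hardy_potential N (r k) + (N - 2)) + (1 - m) * (N - 2) - (if r k \<le> d / 2 then 0 else pi\<^sup>2 / d\<^sup>2)"
proof -
  define A B where "A = (N - 2)\<^sup>2 / 4" "B = (N - 2) * (N - 3) / 2"
  have AB: "A \<ge> 0" "B \<ge> 0" using N by (auto simp: A_B_def)
  define W where "W = A * (1 / d\<^sup>2) + B * hardy_g (d / 2)"
  have g: "hardy_g (d / 2) \<ge> 0" using hardy_g_nonneg[of "d/2"] d by simp
  have W: "W \<ge> 0" using AB g by (simp add: W_def)
  have V: "hardy_potential N s = A * (1 / s\<^sup>2) + B * hardy_g s" for s
    by (simp add: hardy_potential_def A_B_def)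
  have m: "0 \<le> m" "m \<le> 1" using sin_cut_bounds by (auto simp: m_def)
  have "hardy_potential N (r j) \<le> W" if "j \<in> I" "j \<noteq> k" for j
  proof -
    have rj: "r j \<ge> d" using far that by simp
    then have "1 / (r j)\<^sup>2 \<le> 1 / d\<^sup>2" using d by (intro divide_left_mono power_mono) auto
    moreover have "hardy_g (r j) \<le> hardy_g (d / 2)" using rj d by (intro hardy_g_antimono) auto
    ultimately show ?thesis unfolding V W_def using AB by (intro add_mono mult_left_mono) auto
  qed
  then have "(\<Sum>j\<in>I - {k}. hardy_potential N (r j)) \<le> (\<Sum>j\<in>I - {k}. W)" by (intro sum_mono) auto
  also have "\<dots> = (real (card I) - 1) * W"
  proof -
    have "card I > 0" using I by (auto simp: card_gt_0_iff)
    then show ?thesis using I by (simp add: of_nat_diff)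
  qed
  finally have far_sum: "(\<Sum>j\<in>I - {k}. hardy_potential N (r j)) \<le> (real (card I) - 1) * W" .
  have near: "(1 - m) * hardy_potential N (r k) \<le> 2 * W"
  proof (cases "r k \<le> d / 2")
    case True
    then have "m = 1" using d by (simp add: m_def field_simps)
    then show ?thesis using W by simp
  next
    case False
    have "(1 - m) * (1 / (r k)\<^sup>2) \<le> (2 * (r k / d)\<^sup>2) * (1 / (r k)\<^sup>2)"
      using one_minus_sin_cut_le[of "r k / d"] rk d by (intro mult_right_mono) (auto simp: m_def)
    also have "\<dots> = 2 * (1 / d\<^sup>2)" using rk by (simp add: power_divide)
    finally have 1: "(1 - m) * (1 / (r k)\<^sup>2) \<le> 2 * (1 / d\<^sup>2)" .
    have "(1 - m) * hardy_g (r k) \<le> 1 * hardy_g (d / 2)"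
      using m False d hardy_g_nonneg[OF rk] by (intro mult_mono hardy_g_antimono) auto
    then have 2: "(1 - m) * hardy_g (r k) \<le> 2 * hardy_g (d / 2)" using g by simp
    have "(1 - m) * hardy_potential N (r k) = A * ((1 - m) * (1 / (r k)\<^sup>2)) + B * ((1 - m) * hardy_g (r k))"
      by (simp add: V algebra_simps)
    also have "\<dots> \<le> A * (2 * (1 / d\<^sup>2)) + B * (2 * hardy_g (d / 2))"
      using 1 2 AB by (intro add_mono mult_left_mono) auto
    finally show ?thesis by (simp add: W_def mult_ac)
  qed
  have "(\<Sum>j\<in>I. hardy_potential N (r j)) = hardy_potential N (r k) + (\<Sum>j\<in>I - {k}. hardy_potential N (r j))"
    using I by (rule sum.remove)
  moreover have "pi\<^sup>2 / d\<^sup>2 + (real (card I) + 1) * W \<le> N - 2"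
    using dbar by (simp add: W_def A_B_def mult_ac)
  moreover have "(if r k \<le> d / 2 then 0 else pi\<^sup>2 / d\<^sup>2) \<le> pi\<^sup>2 / d\<^sup>2" by simp
  ultimately show ?thesis using far_sum near by (simp add: algebra_simps)
qed

text \<open>
  The left-hand side of the threshold equation decreases in the distance.
\<close>

lemma dbar_bound:
  assumes N: "N \<ge> 3" and d: "d \<ge> dbar M N"
  shows "d > 0" "pi\<^sup>2 / d\<^sup>2 + (real M + 1) * ((real N - 2)\<^sup>2 / 4 * (1 / d\<^sup>2)
     + (real N - 3) * (real N - 2) / 2 * hardy_g (d / 2)) \<le> real N - 2"
proof -
  define D where "D = dbar M N"
  have D: "D > 0" "dbar_eq M N D"
    using theI'[OF dbar_ex1[OF N, of M]] by (auto simp: D_def dbar_def)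
  have dD: "d \<ge> D" using d by (simp add: D_def)
  show "d > 0" using D dD by simp
  have i: "1 / d\<^sup>2 \<le> 1 / D\<^sup>2" using D dD by (intro divide_left_mono power_mono) auto
  have p: "pi\<^sup>2 / d\<^sup>2 \<le> pi\<^sup>2 / D\<^sup>2" using mult_left_mono[OF i, of "pi\<^sup>2"] by simp
  have "hardy_g (d / 2) \<le> hardy_g (D / 2)" using D dD by (intro hardy_g_antimono) auto
  then have "pi\<^sup>2 / d\<^sup>2 + (real M + 1) * ((real N - 2)\<^sup>2 / 4 * (1 / d\<^sup>2)
     + (real N - 3) * (real N - 2) / 2 * hardy_g (d / 2)) \<le> 
    pi\<^sup>2 / D\<^sup>2 + (real M + 1) * ((real N - 2)\<^sup>2 / 4 * (1 / D\<^sup>2)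
     + (real N - 3) * (real N - 2) / 2 * hardy_g (D / 2))"
    using i N by (intro add_mono mult_left_mono p) auto
  also have "\<dots> = real N - 2" using D by (simp add: dbar_eq_def)
  finally show "pi\<^sup>2 / d\<^sup>2 + (real M + 1) * ((real N - 2)\<^sup>2 / 4 * (1 / d\<^sup>2)
     + (real N - 3) * (real N - 2) / 2 * hardy_g (d / 2)) \<le> real N - 2" .
qed

section \<open>The multipolar inequality in Euclidean coordinates\<close>

text \<open>
  The hyperbolic inequality written out in the ball: \<open>p\<close> is the Euclidean gradient of \<open>u\<close>,
  hyperbolic volume has density \<open>q\<^sup>N\<close> and the squared hyperbolic length of a gradient is \<open>q\<^bsup>-2\<^esup>\<close>
  times the Euclidean one. The integral of the divergence of \<open>u\<^sup>2\<close> times the glued field vanishes,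
  so it can be added to the right-hand integrand, which then dominates the left-hand integrand
  at every point. The last assumption on the poles says that the balls of radius \<open>d\<close> about
  them are disjoint: every point has distance at least \<open>d\<close> from all poles except one.
\<close>

lemma multipolar_hardy_away_from_poles:
  fixes y :: "'i \<Rightarrow> 'a::euclidean_space" and u :: "'a \<Rightarrow> real"
  assumes n: "DIM('a) = n + 2" "n \<ge> 1"
    and I: "finite I" "I \<noteq> {}" and y: "\<And>k. k \<in> I \<Longrightarrow> norm (y k) < 1"
    and K: "compact K" "K \<subseteq> ball 0 1" and out: "\<And>x. x \<in> ball 0 1 - K \<Longrightarrow> u x = 0"
    and du: "\<And>x. x \<in> ball 0 1 \<Longrightarrow> (u has_derivative (\<lambda>v. p x \<bullet> v)) (at x)"
    and cp: "continuous_on (ball 0 1) p"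
    and d: "d > 0"
    and dbar: "pi\<^sup>2 / d\<^sup>2 + (real (card I) + 1) * ((real DIM('a) - 2)\<^sup>2 / 4 * (1 / d\<^sup>2)
      + (real DIM('a) - 3) * (real DIM('a) - 2) / 2 * hardy_g (d / 2)) \<le> real DIM('a) - 2"
    and sep: "\<And>x. x \<in> ball 0 1 \<Longrightarrow> \<exists>k\<in>I. \<forall>j\<in>I - {k}. arcosh (cosh_dist (y j) x) \<ge> d"
    and e: "e > 0" "e \<le> d / 2"
  shows "(\<integral>\<^sup>+x. (if x \<in> ball 0 1 \<and> (\<forall>k\<in>I. cosh_dist (y k) x \<ge> cosh e)
       then ennreal (conf_factor x ^ DIM('a) * (\<Sum>k\<in>I. hardy_potential (real DIM('a)) (arcosh (cosh_dist (y k) x))) * (u x)\<^sup>2)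
       else 0) \<partial>lborel)
    \<le> (\<integral>\<^sup>+x. (if x \<in> ball 0 1 then ennreal (conf_factor x ^ n * (p x \<bullet> p x)) else 0) \<partial>lborel)"
proof -
  define S where "S = ball (0::'a) 1"
  define N where "N = real DIM('a)"
  have N: "N \<ge> 3" "N = real (n + 2)" using n by (auto simp: N_def)
  have oS: "open S" by (simp add: S_def)
  have in_S: "x \<in> S \<longleftrightarrow> norm x < 1" for x by (simp add: S_def)
  define U where "U = (\<lambda>x. if x \<in> S then u x else 0)"
  have U0: "U x = 0" if "x \<notin> K" for x using out that by (auto simp: U_def S_def)
  have dU: "(U has_derivative (\<lambda>v. p x \<bullet> v)) (at x)" if "x \<in> S" for x
    by (rule has_derivative_transform_within_open[OF du oS]) (use that in \<open>auto simp: U_def S_def\<close>)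
  have cU: "continuous_on S U"
    using dU oS by (meson continuous_on_eq_continuous_at has_derivative_continuous)
  have cpS: "continuous_on S p" using cp by (simp add: S_def)
  have cc: "continuous_on S (cosh_dist z)" "continuous_on S (grad_cosh_dist z)" for z
    unfolding S_def by (intro continuous_intros)+
  have dc: "(cosh_dist z has_derivative (\<lambda>v. grad_cosh_dist z x \<bullet> v)) (at x)" if "x \<in> S" "norm z < 1" for x z
    using cosh_dist_has_derivative[of x z] that in_S by blast
  have c0: "cosh_dist 0 x \<ge> 1" if "x \<in> S" for x using cosh_dist_ge_1[of x 0] that in_S by simp

  \<comment> \<open>The field is \<open>B(c\<^sub>k) \<nabla>c\<^sub>k\<close> summed over the poles, plus \<open>(1 - \<Sum>\<^sub>k m\<^sub>k) \<nabla>c\<^sub>0 / c\<^sub>0\<close>.\<close>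
  define B where "B = (\<lambda>c. ball_cut d c * cut_slope N e c)"
  define B' where "B' = (\<lambda>c. ball_cut' d c * cut_slope N e c + ball_cut d c * cut_slope' N e c)"
  have dB: "(B has_real_derivative B' c) (at c)" for c
    unfolding B_def B'_def
    by (auto intro!: derivative_eq_intros ball_cut_DERIV[OF d] cut_slope_DERIV[OF e(1)])
  have cm: "continuous_on UNIV (ball_cut d)" "continuous_on UNIV (cut_slope N e)"
    using ball_cut_DERIV[OF d] cut_slope_DERIV[OF e(1)]
    by (meson DERIV_isCont continuous_at_imp_continuous_on)+
  note cm' = continuous_on_ball_cut'[OF d] continuous_on_cut_slope'[OF e(1), of N]
  have cB: "continuous_on UNIV B" "continuous_on UNIV B'"
    unfolding B_def B'_def by (intro continuous_intros cm cm')+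
  note comp = continuous_on_compose2[where s=S and t=UNIV, OF _ cc(1)]

  define h where "h = (\<lambda>k x. (U x)\<^sup>2 * B (cosh_dist (y k) x))"
  define h' where "h' = (\<lambda>k x v. 2 * U x * (p x \<bullet> v) * B (cosh_dist (y k) x)
      + (U x)\<^sup>2 * (B' (cosh_dist (y k) x) * (grad_cosh_dist (y k) x \<bullet> v)))"
  define h0 where "h0 = (\<lambda>x. (U x)\<^sup>2 * ((1 - (\<Sum>k\<in>I. ball_cut d (cosh_dist (y k) x))) / cosh_dist 0 x))"
  define h0' where "h0' = (\<lambda>x v. 2 * U x * (p x \<bullet> v) * ((1 - (\<Sum>k\<in>I. ball_cut d (cosh_dist (y k) x))) / cosh_dist 0 x)
      + (U x)\<^sup>2 * (- (\<Sum>k\<in>I. ball_cut' d (cosh_dist (y k) x) * (grad_cosh_dist (y k) x \<bullet> v)) / cosh_dist 0 x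
         - (1 - (\<Sum>k\<in>I. ball_cut d (cosh_dist (y k) x))) * (grad_cosh_dist 0 x \<bullet> v) / (cosh_dist 0 x)\<^sup>2))"
  have dU2: "((\<lambda>x. (U x)\<^sup>2) has_derivative (\<lambda>v. 2 * U x * (p x \<bullet> v))) (at x)" if "x \<in> S" for x
    by (auto intro!: derivative_eq_intros dU[OF that])
  have dcomp: "((\<lambda>x. f (cosh_dist (y k) x)) has_derivative (\<lambda>v. f' (cosh_dist (y k) x) * (grad_cosh_dist (y k) x \<bullet> v))) (at x)"
    if "x \<in> S" "k \<in> I" "\<And>c. (f has_real_derivative f' c) (at c)" for x k and f f' :: "real \<Rightarrow> real"
    using has_derivative_compose[OF dc[OF that(1) y[OF that(2)]] that(3)[unfolded has_field_derivative_def]] .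
  have dh: "(h k has_derivative h' k x) (at x)" if "x \<in> S" "k \<in> I" for k x
  proof -
    have "((\<lambda>x. (U x)\<^sup>2 * B (cosh_dist (y k) x)) has_derivative
       (\<lambda>v. (U x)\<^sup>2 * (B' (cosh_dist (y k) x) * (grad_cosh_dist (y k) x \<bullet> v))
          + 2 * U x * (p x \<bullet> v) * B (cosh_dist (y k) x))) (at x)"
      by (rule has_derivative_mult[OF dU2[OF that(1)] dcomp[OF that dB]])
    then show ?thesis unfolding h_def h'_def by (simp add: add.commute)
  qed
  have ch: "continuous_on S (\<lambda>x. h' k x v)" for k v
    unfolding h'_def by (intro continuous_intros cU cpS cc comp[OF cB(1)] comp[OF cB(2)]) auto
  have dh0: "(h0 has_derivative h0' x) (at x)" if x: "x \<in> S" for x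
  proof -
    have ds: "((\<lambda>x. 1 - (\<Sum>k\<in>I. ball_cut d (cosh_dist (y k) x))) has_derivative
        (\<lambda>v. 0 - (\<Sum>k\<in>I. ball_cut' d (cosh_dist (y k) x) * (grad_cosh_dist (y k) x \<bullet> v)))) (at x)"
      by (intro has_derivative_diff has_derivative_const has_derivative_sum dcomp[OF x] ball_cut_DERIV[OF d])
    have dq: "((\<lambda>x. (1 - (\<Sum>k\<in>I. ball_cut d (cosh_dist (y k) x))) / cosh_dist 0 x) has_derivative
       (\<lambda>v. - (\<Sum>k\<in>I. ball_cut' d (cosh_dist (y k) x) * (grad_cosh_dist (y k) x \<bullet> v)) / cosh_dist 0 x
         - (1 - (\<Sum>k\<in>I. ball_cut d (cosh_dist (y k) x))) * (grad_cosh_dist 0 x \<bullet> v) / (cosh_dist 0 x)\<^sup>2)) (at x)"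
      using has_derivative_divide'[OF ds dc[OF x, of 0]] c0[OF x]
      by (auto elim!: has_derivative_eq_rhs simp: fun_eq_iff field_simps power2_eq_square)
    have "((\<lambda>x. (U x)\<^sup>2 * ((1 - (\<Sum>k\<in>I. ball_cut d (cosh_dist (y k) x))) / cosh_dist 0 x)) has_derivative
       (\<lambda>v. (U x)\<^sup>2 * (- (\<Sum>k\<in>I. ball_cut' d (cosh_dist (y k) x) * (grad_cosh_dist (y k) x \<bullet> v)) / cosh_dist 0 x
         - (1 - (\<Sum>k\<in>I. ball_cut d (cosh_dist (y k) x))) * (grad_cosh_dist 0 x \<bullet> v) / (cosh_dist 0 x)\<^sup>2)
         + 2 * U x * (p x \<bullet> v) * ((1 - (\<Sum>k\<in>I. ball_cut d (cosh_dist (y k) x))) / cosh_dist 0 x))) (at x)"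
      by (rule has_derivative_mult[OF dU2[OF x] dq])
    then show ?thesis unfolding h0_def h0'_def by (simp add: add.commute)
  qed
  have ch0: "continuous_on S (\<lambda>x. h0' x v)" for v
  proof -
    have "\<forall>x\<in>S. cosh_dist 0 x \<noteq> 0" "\<forall>x\<in>S. (cosh_dist 0 x)\<^sup>2 \<noteq> 0" using c0 by fastforce+
    then show ?thesis
      unfolding h0'_def by (intro continuous_intros cU cpS cc comp[OF cm(1)] comp[OF cm'(1)]) auto
  qed

  have dE: "(weighted_grad n z has_derivative weighted_grad' n z x) (at x)" if "x \<in> S" for x z
    using weighted_grad_has_derivative that in_S by blast
  have cE: "continuous_on S (\<lambda>x. weighted_grad' n z x v)" for z v
    unfolding S_def by (rule continuous_on_weighted_grad')
  define D where "D = (\<lambda>k x. if x \<in> S then h' k x (weighted_grad n (y k) x)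
      + h k x * (\<Sum>b\<in>Basis. weighted_grad' n (y k) x b \<bullet> b) else 0)"
  define D0 where "D0 = (\<lambda>x. if x \<in> S then h0' x (weighted_grad n 0 x)
      + h0 x * (\<Sum>b\<in>Basis. weighted_grad' n 0 x b \<bullet> b) else 0)"
  have D: "integrable lborel (D k)" "(LINT x|lborel. D k x) = 0" if "k \<in> I" for k
    unfolding D_def
    by (rule integral_div_scaleR_eq_0[OF oS K(1) K(2)[folded S_def] _ dh[OF _ that] ch dE cE];
        simp add: h_def U0)+
  have D0: "integrable lborel D0" "(LINT x|lborel. D0 x) = 0"
    unfolding D0_def
    by (rule integral_div_scaleR_eq_0[OF oS K(1) K(2)[folded S_def] _ dh0 ch0 dE cE];
        simp add: h0_def U0)+
  define G where "G = (\<lambda>x. if x \<in> S then conf_factor x ^ n * (p x \<bullet> p x) else 0)"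
  have p0: "p x = 0" if "x \<in> S" "x \<notin> K" for x
  proof -
    have "open (- K)" using K by (simp add: compact_imp_closed open_Compl)
    then have "((\<lambda>x. 0::real) has_derivative (\<lambda>v. p x \<bullet> v)) (at x)"
      by (rule has_derivative_transform_within_open[OF dU[OF that(1)]]) (use that U0 in auto)
    then have "(\<lambda>v. p x \<bullet> v) = (\<lambda>v. 0)" using has_derivative_unique has_derivative_const by blast
    then have "p x \<bullet> p x = 0" by meson
    then show ?thesis by simp
  qed
  have G: "integrable lborel G"
  proof -
    have "continuous_on K (\<lambda>x. conf_factor x ^ n * (p x \<bullet> p x))"
      by (intro continuous_intros continuous_on_subset[OF cp] continuous_on_subset[OF continuous_on_conf_factor] K(2))
    then have "integrable lborel (\<lambda>x. indicator K x *\<^sub>R (conf_factor x ^ n * (p x \<bullet> p x)))"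
      by (rule borel_integrable_compact[OF K(1)])
    moreover have "(\<lambda>x. indicator K x *\<^sub>R (conf_factor x ^ n * (p x \<bullet> p x))) = G"
      using K(2) p0 by (auto simp: G_def fun_eq_iff indicator_def S_def)
    ultimately show ?thesis by simp
  qed
  define T where "T = (\<lambda>x. G x + ((\<Sum>k\<in>I. D k x) + D0 x))"
  have T: "integrable lborel T" "(LINT x|lborel. T x) = (LINT x|lborel. G x)"
    unfolding T_def using G D D0 by auto

  define F where "F = (\<lambda>x. if x \<in> S \<and> (\<forall>k\<in>I. cosh_dist (y k) x \<ge> cosh e)
       then conf_factor x ^ DIM('a) * (\<Sum>k\<in>I. hardy_potential N (arcosh (cosh_dist (y k) x))) * (u x)\<^sup>2 else 0)"
  have F0: "F x \<ge> 0" for x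
  proof (cases "x \<in> S \<and> (\<forall>k\<in>I. cosh_dist (y k) x \<ge> cosh e)")
    case True
    have "arcosh (cosh_dist (y k) x) > 0" if "k \<in> I" for k
    proof -
      have "cosh_dist (y k) x \<ge> cosh e" "cosh e > 1"
        using True that cosh_real_strict_mono[of 0 e] e by auto
      then show ?thesis by simp
    qed
    then have "(\<Sum>k\<in>I. hardy_potential N (arcosh (cosh_dist (y k) x))) \<ge> 0"
      using N by (intro sum_nonneg hardy_potential_nonneg) auto
    moreover have "conf_factor x > 0" using True in_S conf_factor_pos by blast
    ultimately show ?thesis using True by (simp add: F_def)
  qed (auto simp: F_def)
  have FT: "F x \<le> T x" for x
  proof (cases "x \<in> S")
    case False
    then show ?thesis by (simp add: F_def T_def G_def D_def D0_def)
  next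
    case True
    have nx: "norm x < 1" using True in_S by simp
    obtain k where k: "k \<in> I" "\<And>j. j \<in> I \<Longrightarrow> j \<noteq> k \<Longrightarrow> arcosh (cosh_dist (y j) x) \<ge> d"
      using sep[of x] True by (auto simp: S_def)
    define c where "c = cosh_dist (y k) x"
    have c: "c \<ge> 1" using cosh_dist_ge_1[OF nx y[OF k(1)]] by (simp add: c_def)
    define q where "q = conf_factor x"
    have q: "q > 0" using conf_factor_pos[OF nx] by (simp add: q_def)
    define v w where "v = grad_cosh_dist (y k) x" "w = grad_cosh_dist 0 x"
    define c0 where "c0 = cosh_dist 0 x"
    have c0: "c0 \<ge> 1" using c0[OF True] by (simp add: c0_def)
    define m m' b b' where "m = ball_cut d c" "m' = ball_cut' d c" "b = cut_slope N e c" "b' = cut_slope' N e c"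
    have cut0: "ball_cut d (cosh_dist (y j) x) = 0" "ball_cut' d (cosh_dist (y j) x) = 0" if "j \<in> I" "j \<noteq> k" for j
    proof -
      have "cosh_dist (y j) x \<ge> 1" using cosh_dist_ge_1[OF nx y[OF that(1)]] .
      then have "cosh_dist (y j) x \<ge> cosh d"
        using k(2)[OF that] arcosh_less_iff[of "cosh_dist (y j) x" d] d by fastforce
      then show "ball_cut d (cosh_dist (y j) x) = 0" "ball_cut' d (cosh_dist (y j) x) = 0"
        using ball_cut_eq_0[OF d] by auto
    qed
    \<comment> \<open>Only the cut-off of the pole \<open>k\<close> can be different from \<open>0\<close> at \<open>x\<close>.\<close>
    have collapse: "(\<Sum>j\<in>I. f j) = f k" if "\<And>j. j \<in> I \<Longrightarrow> j \<noteq> k \<Longrightarrow> f j = 0" for f :: "'i \<Rightarrow> real"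
      using sum.remove[OF I(1) k(1), of f] that by simp
    have s1: "(\<Sum>j\<in>I. D j x) = D k x"
      by (rule collapse) (simp add: D_def h_def h'_def B_def B'_def cut0)
    have s2: "(\<Sum>j\<in>I. ball_cut d (cosh_dist (y j) x)) = m"
      using collapse[of "\<lambda>j. ball_cut d (cosh_dist (y j) x)"] cut0 by (simp add: m_m'_b_b'_def c_def)
    have s3: "(\<Sum>j\<in>I. ball_cut' d (cosh_dist (y j) x) * (grad_cosh_dist (y j) x \<bullet> z)) = m' * (v \<bullet> z)" for z
      using collapse[of "\<lambda>j. ball_cut' d (cosh_dist (y j) x) * (grad_cosh_dist (y j) x \<bullet> z)"] cut0
      by (simp add: m_m'_b_b'_def c_def v_w_def)
    have qN: "q ^ DIM('a) = q ^ n * q\<^sup>2" using n by (simp add: power_add power2_eq_square)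
    have Ux: "U x = u x" using True by (simp add: U_def)
    have dv: "(\<Sum>b\<in>Basis. weighted_grad' n (y k) x b \<bullet> b) = N * (q ^ n * q\<^sup>2) * c"
      using divergence_weighted_grad[OF nx y[OF k(1)] n(1)] qN unfolding N_def c_def q_def by simp
    have dv0: "(\<Sum>b\<in>Basis. weighted_grad' n 0 x b \<bullet> b) = N * (q ^ n * q\<^sup>2) * c0"
      using divergence_weighted_grad[OF nx _ n(1), of 0] qN unfolding N_def c0_def q_def by simp
    have Dk: "D k x = q ^ n * (2 * u x * (p x \<bullet> v) * (m * b) + (u x)\<^sup>2 * ((m' * b + m * b') * (v \<bullet> v)))
        + (u x)\<^sup>2 * (m * b) * (N * (q ^ n * q\<^sup>2) * c)"
      using True unfolding D_def h_def h'_def dv weighted_grad_def B_def B'_def Ux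
        c_def[symmetric] q_def[symmetric] m_m'_b_b'_def[symmetric] v_w_def[symmetric]
      by (simp add: algebra_simps)
    have cz: "(u x)\<^sup>2 * ((1 - m) / c0) * (N * (q ^ n * q\<^sup>2) * c0) = (u x)\<^sup>2 * (1 - m) * (N * (q ^ n * q\<^sup>2))"
      using c0 by simp
    have D0x: "D0 x = q ^ n * (2 * u x * (p x \<bullet> w) * ((1 - m) / c0)
         + (u x)\<^sup>2 * (- (m' * (v \<bullet> w)) / c0 - (1 - m) * (w \<bullet> w) / c0\<^sup>2))
        + (u x)\<^sup>2 * (1 - m) * (N * (q ^ n * q\<^sup>2))"
      using True c0 unfolding D0_def h0_def h0'_def dv0 s2 s3 unfolding weighted_grad_def Ux
        c0_def[symmetric] q_def[symmetric] v_w_def[symmetric] cz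
      by (simp add: algebra_simps)
    define K1 where "K1 = (if c \<le> cosh (d / 2) then 0 else pi\<^sup>2 / d\<^sup>2)"
    define R where "R = (if c \<ge> cosh e then hardy_potential N (arcosh c) + (N - 2) else 0)"
    have loc: "(u x)\<^sup>2 * q\<^sup>2 * (m * R + (1 - m) * (N - 2) - K1) \<le>
      p x \<bullet> p x + 2 * u x * (m * b * (p x \<bullet> v) + (1 - m) * (p x \<bullet> w) / c0)
      + (u x)\<^sup>2 * ((m' * b + m * b') * (v \<bullet> v) - m' * (v \<bullet> w) / c0 - (1 - m) * (w \<bullet> w) / c0\<^sup>2)
      + (u x)\<^sup>2 * N * q\<^sup>2 * (m * b * c + (1 - m))"
    proof (rule localized_field_ineq)
      show "0 \<le> m" "m \<le> 1" using ball_cut_bounds by (auto simp: m_m'_b_b'_def)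
      show "K1 \<ge> 0" by (simp add: K1_def)
      show "v \<bullet> v = q\<^sup>2 * (c\<^sup>2 - 1)"
        using grad_cosh_dist_sq[OF nx y[OF k(1)]] by (simp add: v_w_def q_def c_def)
      show "w \<bullet> w = q\<^sup>2 * (c0\<^sup>2 - 1)"
        using grad_cosh_dist_sq[OF nx, of 0] by (simp add: v_w_def q_def c0_def)
      show "m'\<^sup>2 * (c\<^sup>2 - 1) \<le> 4 * K1 * (m * (1 - m))"
        using ball_cut'_sq[OF d c] ball_cut_eq_1[OF d, of c] by (simp add: K1_def m_m'_b_b'_def)
      show "R \<le> b' * (c\<^sup>2 - 1) + N * c * b - b\<^sup>2 * (c\<^sup>2 - 1)"
        unfolding R_def m_m'_b_b'_def by (rule cut_slope_riccati[OF c e(1) N(1)])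
    qed (use c0 in auto)
    have Tx: "T x = q ^ n * (p x \<bullet> p x + 2 * u x * (m * b * (p x \<bullet> v) + (1 - m) * (p x \<bullet> w) / c0)
      + (u x)\<^sup>2 * ((m' * b + m * b') * (v \<bullet> v) - m' * (v \<bullet> w) / c0 - (1 - m) * (w \<bullet> w) / c0\<^sup>2)
      + (u x)\<^sup>2 * N * q\<^sup>2 * (m * b * c + (1 - m)))"
      unfolding T_def s1 Dk D0x using True
      by (simp add: G_def q_def[symmetric] algebra_simps)
    have low: "T x \<ge> q ^ n * ((u x)\<^sup>2 * q\<^sup>2 * (m * R + (1 - m) * (N - 2) - K1))"
      unfolding Tx using loc q by (intro mult_left_mono) auto
    show ?thesis
    proof (cases "c \<ge> cosh e")
      case False
      then have "c \<le> cosh (d / 2)" using e cosh_real_nonneg_le_iff[of e "d/2"] by linarith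
      then have "m = 1" "K1 = 0" using ball_cut_eq_1[OF d] by (auto simp: m_m'_b_b'_def K1_def)
      moreover have "R = 0" using False by (simp add: R_def)
      moreover have "F x = 0" using False k(1) by (auto simp: F_def c_def)
      ultimately show ?thesis using low by simp
    next
      case ce: True
      have "cosh e > 1" using cosh_real_strict_mono[of 0 e] e by simp
      then have c1: "c > 1" using ce by simp
      have r: "arcosh c > 0" using c1 by simp
      have m: "m = sin_cut (arcosh c / d)" using c1 by (simp add: m_m'_b_b'_def ball_cut_def)
      have K1: "K1 = (if arcosh c \<le> d / 2 then 0 else pi\<^sup>2 / d\<^sup>2)"
        using arcosh_le_iff[OF c, of "d/2"] d by (simp add: K1_def)
      have "(\<Sum>j\<in>I. hardy_potential N (arcosh (cosh_dist (y j) x))) \<le> m * R + (1 - m) * (N - 2) - K1"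
        using hardy_potential_sum_le[of N d I k "\<lambda>j. arcosh (cosh_dist (y j) x)"] N(1) d dbar I k r ce
        unfolding m K1 R_def by (simp add: N_def c_def)
      then have "F x \<le> q ^ DIM('a) * (m * R + (1 - m) * (N - 2) - K1) * (u x)\<^sup>2"
        if "\<forall>k\<in>I. cosh_dist (y k) x \<ge> cosh e"
        using that True q by (auto simp: F_def q_def[symmetric] intro!: mult_right_mono mult_left_mono)
      moreover have "0 \<le> m * R + (1 - m) * (N - 2) - K1"
      proof -
        have "0 \<le> hardy_potential N (arcosh (cosh_dist (y j) x))" if "j \<in> I" for j
        proof (cases "j = k")
          case True
          then show ?thesis using hardy_potential_nonneg r N by (simp add: c_def)
        next
          case False
          then show ?thesis using hardy_potential_nonneg k(2)[OF that] d N by simp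
        qed
        then show ?thesis using \<open>(\<Sum>j\<in>I. _ j) \<le> m * R + _ - K1\<close> sum_nonneg
          by (metis (mono_tags, lifting) order_trans)
      qed
      ultimately have "F x \<le> q ^ DIM('a) * (m * R + (1 - m) * (N - 2) - K1) * (u x)\<^sup>2"
        using q by (cases "\<forall>k\<in>I. cosh_dist (y k) x \<ge> cosh e") (auto simp: F_def)
      then show ?thesis using low by (simp add: qN mult_ac)
    qed
  qed

  have "(\<integral>\<^sup>+x. ennreal (F x) \<partial>lborel) \<le> (\<integral>\<^sup>+x. ennreal (T x) \<partial>lborel)"
    using FT by (intro nn_integral_mono ennreal_leI)
  also have "\<dots> = ennreal (LINT x|lborel. T x)"
    by (intro nn_integral_eq_integral T AE_I2 order_trans[OF F0 FT])
  also have "\<dots> = ennreal (LINT x|lborel. G x)" unfolding T ..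
  also have "\<dots> = (\<integral>\<^sup>+x. ennreal (G x) \<partial>lborel)"
    by (intro nn_integral_eq_integral[symmetric] G AE_I2) (simp add: G_def in_S less_imp_le[OF conf_factor_pos])
  finally show ?thesis
    unfolding F_def G_def S_def N_def by (simp add: if_distrib[of ennreal] cong: if_cong)
qed

lemma borel_measurable_conf_factor [measurable]: "(conf_factor :: 'a::euclidean_space \<Rightarrow> real) \<in> borel_measurable borel"
  unfolding conf_factor_def[abs_def] by measurable

lemma borel_measurable_cosh_dist [measurable]:
  "(cosh_dist y :: 'a::euclidean_space \<Rightarrow> real) \<in> borel_measurable borel"
  unfolding cosh_dist_def[abs_def] by measurable

lemma borel_measurable_arcosh [measurable]: "(arcosh :: real \<Rightarrow> real) \<in> borel_measurable borel"
  unfolding arcosh_def[abs_def] by simp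

lemma borel_measurable_hardy_g [measurable]: "hardy_g \<in> borel_measurable borel"
proof -
  have [measurable]: "(cosh :: real \<Rightarrow> real) \<in> borel_measurable borel" "(sinh :: real \<Rightarrow> real) \<in> borel_measurable borel"
    by (intro borel_measurable_continuous_onI continuous_intros)+
  show ?thesis unfolding hardy_g_def[abs_def] by measurable
qed

lemma borel_measurable_hardy_potential [measurable]: "hardy_potential N \<in> borel_measurable borel"
  unfolding hardy_potential_def[abs_def] by measurable

text \<open>
  The cut-off radius tends to zero along a sequence that makes the truncated potentials increase.
  At the poles themselves, a null set, the truncated potentials stay zero.
\<close>

lemma multipolar_hardy:
  fixes y :: "'i \<Rightarrow> 'a::euclidean_space" and u :: "'a \<Rightarrow> real"
  assumes n: "DIM('a) = n + 2" "n \<ge> 1"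
    and I: "finite I" "I \<noteq> {}" and y: "\<And>k. k \<in> I \<Longrightarrow> norm (y k) < 1"
    and K: "compact K" "K \<subseteq> ball 0 1" and out: "\<And>x. x \<in> ball 0 1 - K \<Longrightarrow> u x = 0"
    and du: "\<And>x. x \<in> ball 0 1 \<Longrightarrow> (u has_derivative (\<lambda>v. p x \<bullet> v)) (at x)"
    and cp: "continuous_on (ball 0 1) p"
    and d: "d > 0"
    and dbar: "pi\<^sup>2 / d\<^sup>2 + (real (card I) + 1) * ((real DIM('a) - 2)\<^sup>2 / 4 * (1 / d\<^sup>2)
      + (real DIM('a) - 3) * (real DIM('a) - 2) / 2 * hardy_g (d / 2)) \<le> real DIM('a) - 2"
    and sep: "\<And>x. x \<in> ball 0 1 \<Longrightarrow> \<exists>k\<in>I. \<forall>j\<in>I - {k}. arcosh (cosh_dist (y j) x) \<ge> d"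
  shows "(\<integral>\<^sup>+x. (if x \<in> ball 0 1
       then ennreal (conf_factor x ^ DIM('a) * (\<Sum>k\<in>I. hardy_potential (real DIM('a)) (arcosh (cosh_dist (y k) x))) * (u x)\<^sup>2)
       else 0) \<partial>lborel)
    \<le> (\<integral>\<^sup>+x. (if x \<in> ball 0 1 then ennreal (conf_factor x ^ n * (p x \<bullet> p x)) else 0) \<partial>lborel)"
    (is "(\<integral>\<^sup>+x. ?F x \<partial>lborel) \<le> ?R")
proof -
  define e where "e = (\<lambda>i. d / (2 * real (Suc i)))"
  have e: "e i > 0" "e i \<le> d / 2" for i
    using d by (auto simp: e_def field_simps)
  define A where "A = (\<lambda>i. {x \<in> ball 0 1. \<forall>k\<in>I. cosh_dist (y k) x \<ge> cosh (e i)})"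
  define F where "F = (\<lambda>i x. if x \<in> A i then ?F x else 0)"
  have "continuous_on (ball 0 1) u"
    using du by (meson continuous_on_eq_continuous_at has_derivative_continuous open_ball)
  then have U: "(\<lambda>x. indicator (ball 0 1) x *\<^sub>R u x) \<in> borel_measurable borel"
    by (intro borel_measurable_continuous_on_indicator) auto
  have F_eq: "?F = (\<lambda>x. ennreal (conf_factor x ^ DIM('a) *
     (\<Sum>k\<in>I. hardy_potential (real DIM('a)) (arcosh (cosh_dist (y k) x))) * (indicator (ball 0 1) x *\<^sub>R u x)\<^sup>2))"
    by (auto simp: fun_eq_iff indicator_def)
  have mF: "?F \<in> borel_measurable lborel"
    unfolding F_eq using U by measurable
  have mA: "A i \<in> sets lborel" for i
  proof -
    have "A i = ball 0 1 \<inter> (\<Inter>k\<in>I. {x \<in> space borel. cosh_dist (y k) x \<ge> cosh (e i)})"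
      using I by (auto simp: A_def)
    also have "\<dots> \<in> sets borel"
      using I by (intro sets.Int sets.finite_INT) measurable
    finally show ?thesis by simp
  qed
  have mFi: "F i \<in> borel_measurable lborel" for i
    unfolding F_def using mF mA by measurable
  have Fi: "(\<integral>\<^sup>+x. F i x \<partial>lborel) \<le> ?R" for i
  proof -
    have "F i = (\<lambda>x. if x \<in> ball 0 1 \<and> (\<forall>k\<in>I. cosh_dist (y k) x \<ge> cosh (e i))
       then ennreal (conf_factor x ^ DIM('a) * (\<Sum>k\<in>I. hardy_potential (real DIM('a)) (arcosh (cosh_dist (y k) x))) * (u x)\<^sup>2)
       else 0)"
      by (auto simp: F_def A_def fun_eq_iff)
    then show ?thesis
      using multipolar_hardy_away_from_poles[OF n I y K out du cp d dbar sep e(1)[of i] e(2)[of i]] by simp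
  qed
  have decr: "e j \<le> e i" if "i \<le> j" for i j
    using that d by (auto simp: e_def intro!: divide_left_mono)
  have inc: "incseq F"
  proof (rule incseq_SucI, rule le_funI)
    fix i x
    have "cosh (e (Suc i)) \<le> cosh (e i)"
      using decr[of i "Suc i"] e(1)[of i] e(1)[of "Suc i"] by (simp add: cosh_real_nonneg_le_iff)
    then show "F i x \<le> F (Suc i) x"
      by (auto simp: F_def A_def)
  qed
  have sup: "?F x \<le> (SUP i. F i x)" if x: "x \<notin> y ` I" for x
  proof (cases "x \<in> ball 0 1")
    case True
    have e0: "(\<lambda>i. cosh (e i)) \<longlonglongrightarrow> cosh 0"
    proof -
      have "e \<longlonglongrightarrow> 0" unfolding e_def by real_asymp
      then show ?thesis by (rule tendsto_cosh)
    qed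
    have "eventually (\<lambda>i. cosh_dist (y k) x \<ge> cosh (e i)) sequentially" if "k \<in> I" for k
    proof -
      have "cosh_dist (y k) x > 1"
      proof -
        have nx: "norm x < 1" and "x \<noteq> y k" using True x that by auto
        then show ?thesis
          using cosh_dist_ge_1[OF nx y[OF that]] cosh_dist_eq_1_iff[OF nx y[OF that]] by linarith
      qed
      then have "eventually (\<lambda>i. cosh (e i) < cosh_dist (y k) x) sequentially"
        using order_tendstoD(2)[OF e0] by simp
      then show ?thesis by eventually_elim simp
    qed
    then have "eventually (\<lambda>i. \<forall>k\<in>I. cosh_dist (y k) x \<ge> cosh (e i)) sequentially"
      using I by (simp add: eventually_ball_finite)
    then obtain i where "\<forall>k\<in>I. cosh_dist (y k) x \<ge> cosh (e i)"
      using eventually_happens'[OF sequentially_bot] by blast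
    then have "?F x = F i x" using True by (simp add: F_def A_def)
    then show ?thesis using SUP_upper[of i UNIV "\<lambda>i. F i x"] by simp
  qed auto
  have "(\<integral>\<^sup>+x. ?F x \<partial>lborel) \<le> (\<integral>\<^sup>+x. (SUP i. F i x) \<partial>lborel)"
  proof (rule nn_integral_mono_AE)
    have "y ` I \<in> null_sets lborel" using I by (intro finite_imp_null_set_lborel) auto
    then show "AE x in lborel. ?F x \<le> (SUP i. F i x)"
      by (rule AE_I') (use sup in blast)
  qed
  also have "\<dots> = (SUP i. \<integral>\<^sup>+x. F i x \<partial>lborel)"
    by (rule nn_integral_monotone_convergence_SUP[OF inc mFi])
  also have "\<dots> \<le> ?R" using Fi by (rule SUP_least)
  finally show ?thesis .
qed

section \<open>The inequality on hyperbolic space\<close>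

text \<open>
  The integrand \<open>g\<close> is typically arbitrary outside the ball; \<open>f\<close> is a representative that is
  measurable on the whole space.
\<close>

lemma nn_integral_hyp_vol:
  fixes f :: "real ^ 'n \<Rightarrow> ennreal"
  assumes f: "f \<in> borel_measurable borel" and g: "\<And>x. norm x < 1 \<Longrightarrow> g x = f x"
  shows "(\<integral>\<^sup>+x. g x \<partial>hyp_vol) =
    (\<integral>\<^sup>+x. (if norm x < 1 then ennreal (conf_factor x ^ CARD('n)) * f x else 0) \<partial>lborel)"
proof -
  let ?M = "restrict_space lborel (hyp_space :: (real ^ 'n) set)"
  have sp: "space ?M = hyp_space" by (simp add: space_restrict_space)
  have "f \<in> borel_measurable ?M" using f by (intro measurable_restrict_space1) simp
  then have mg: "g \<in> borel_measurable ?M"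
    by (subst measurable_cong[of _ _ f]) (use g sp in \<open>auto simp: hyp_space_def\<close>)
  have mc: "(\<lambda>x::real ^ 'n. ennreal (conf_factor x ^ CARD('n))) \<in> borel_measurable ?M"
    by (intro measurable_restrict_space1) measurable
  have "(\<integral>\<^sup>+x. g x \<partial>hyp_vol) = (\<integral>\<^sup>+x. ennreal (conf_factor x ^ CARD('n)) * g x \<partial>?M)"
    unfolding hyp_vol_def conf_factor_def[symmetric] by (rule nn_integral_density[OF mc mg])
  also have "\<dots> = (\<integral>\<^sup>+x. ennreal (conf_factor x ^ CARD('n)) * g x * indicator hyp_space x \<partial>lborel)"
    by (rule nn_integral_restrict_space) (simp add: hyp_space_def)
  also have "\<dots> = (\<integral>\<^sup>+x. (if norm x < 1 then ennreal (conf_factor x ^ CARD('n)) * f x else 0) \<partial>lborel)"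
    using g by (intro nn_integral_cong) (auto simp: indicator_def hyp_space_def)
  finally show ?thesis .
qed

lemma hyp_norm_hyp_grad_sq:
  assumes x: "norm x < 1" and p: "(u has_derivative (\<lambda>v. p \<bullet> v)) (at x)"
  shows "(hyp_norm x (hyp_grad u x))\<^sup>2 = (p \<bullet> p) / (conf_factor x)\<^sup>2"
proof -
  have q: "conf_factor x > 0" by (rule conf_factor_pos[OF x])
  have m: "hyp_metric x w v = (conf_factor x)\<^sup>2 * (w \<bullet> v)" for w v
    by (simp add: hyp_metric_def conf_factor_def power_divide)
  have fd: "frechet_derivative u (at x) = (\<lambda>v. p \<bullet> v)"
    using frechet_derivative_at[OF p] by simp
  have "hyp_grad u x = (1 / (conf_factor x)\<^sup>2) *\<^sub>R p"
    unfolding hyp_grad_def fd m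
  proof (rule the_equality)
    show "\<forall>v. (conf_factor x)\<^sup>2 * (((1 / (conf_factor x)\<^sup>2) *\<^sub>R p) \<bullet> v) = p \<bullet> v" using q by simp
    fix w assume w: "\<forall>v. (conf_factor x)\<^sup>2 * (w \<bullet> v) = p \<bullet> v"
    have "\<forall>v. ((conf_factor x)\<^sup>2 *\<^sub>R w) \<bullet> v = p \<bullet> v" using w by simp
    then have "p = (conf_factor x)\<^sup>2 *\<^sub>R w" by (metis vector_eq_rdot)
    then show "w = (1 / (conf_factor x)\<^sup>2) *\<^sub>R p" using q by simp
  qed
  then show ?thesis
    using q unfolding power2_norm_eq_inner[of p, symmetric]
    by (simp add: hyp_norm_eq[OF x] power2_eq_square)
qed

theorem corollary2p3:
  fixes y :: "nat \<Rightarrow> real ^ 'n"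
    and M :: nat
    and d :: real
    and u :: "real ^ 'n \<Rightarrow> real"
  assumes "CARD('n) \<ge> 3"
    and "M \<ge> 2"
    and "\<And>k. k \<in> {1..M} \<Longrightarrow> y k \<in> hyp_space"
    and "inj_on y {1..M}"
    and "d = Min {hyp_dist (y j) (y k) / 2 | j k. j \<in> {1..M} \<and> k \<in> {1..M} \<and> j \<noteq> k}"
    and "d \<ge> dbar M CARD('n)"
    and "hyp_test_function u"
  shows "(\<integral>\<^sup>+x. ennreal ((hyp_norm x (hyp_grad u x))\<^sup>2) \<partial>hyp_vol)
    \<ge> ennreal ((real CARD('n) - 2)\<^sup>2 / 4)
        * (\<Sum>k=1..M. \<integral>\<^sup>+x. ennreal ((u x)\<^sup>2 / (hyp_dist x (y k))\<^sup>2) \<partial>hyp_vol)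
      + ennreal ((real CARD('n) - 2) * (real CARD('n) - 3) / 2)
        * (\<Sum>k=1..M. \<integral>\<^sup>+x. ennreal (hardy_g (hyp_dist x (y k)) * (u x)\<^sup>2) \<partial>hyp_vol)"
proof -
  let ?N = "CARD('n)" and ?I = "{1..M}" and ?S = "ball 0 1 :: (real ^ 'n) set"
  have N3: "real ?N \<ge> 3" using assms(1) by simp
  define n where "n = ?N - 2"
  have n: "DIM(real ^ 'n) = n + 2" "n \<ge> 1" "?N = n + 2" using assms(1) by (auto simp: n_def)
  have y: "norm (y k) < 1" if "k \<in> ?I" for k using assms(3)[OF that] by (simp add: hyp_space_def)
  note d = dbar_bound[OF assms(1) assms(6)]
  define \<rho> where "\<rho> = (\<lambda>k x. arcosh (cosh_dist (y k) x))"
  have \<rho>: "hyp_dist x (y k) = \<rho> k x" if "norm x < 1" "k \<in> ?I" for x k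
    using hyp_dist_eq_arcosh[OF that(1) y[OF that(2)]] by (simp add: \<rho>_def)

  have far: "2 * d \<le> hyp_dist (y j) (y k)" if "j \<in> ?I" "k \<in> ?I" "j \<noteq> k" for j k
  proof -
    let ?A = "{hyp_dist (y j) (y k) / 2 | j k. j \<in> ?I \<and> k \<in> ?I \<and> j \<noteq> k}"
    have "?A \<subseteq> (\<lambda>(j, k). hyp_dist (y j) (y k) / 2) ` (?I \<times> ?I)" by force
    then have "finite ?A" by (rule finite_subset) auto
    then have "Min ?A \<le> hyp_dist (y j) (y k) / 2" using that by (intro Min_le) auto
    then show ?thesis using assms(5) by simp
  qed
  \<comment> \<open>The balls of radius \<open>d\<close> about the poles are disjoint.\<close>
  have sep: "\<exists>k\<in>?I. \<forall>j\<in>?I - {k}. arcosh (cosh_dist (y j) x) \<ge> d" if x: "x \<in> ?S" for x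
  proof (cases "\<exists>k\<in>?I. \<rho> k x < d")
    case True
    then obtain k where k: "k \<in> ?I" "\<rho> k x < d" by blast
    have nx: "norm x < 1" using x by simp
    have "\<rho> j x \<ge> d" if "j \<in> ?I - {k}" for j
    proof -
      have "hyp_dist (y k) (y j) \<le> hyp_dist (y k) x + hyp_dist x (y j)"
        using that k y nx by (intro hyp_dist_triangle) auto
      moreover have "hyp_dist (y k) x = \<rho> k x"
        using hyp_dist_eq_arcosh[OF y[OF k(1)] nx] by (simp add: \<rho>_def cosh_dist_commute)
      moreover have "2 * d \<le> hyp_dist (y k) (y j)" using far k that by auto
      ultimately show ?thesis using \<rho>[OF nx, of j] that k by auto
    qed
    then show ?thesis using k(1) unfolding \<rho>_def by blast
  next
    case False
    then have "\<forall>j\<in>?I. \<rho> j x \<ge> d" by force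
    moreover have "1 \<in> ?I" using assms(2) by simp
    ultimately show ?thesis unfolding \<rho>_def by blast
  qed

  obtain K where K: "compact K" "K \<subseteq> ?S" "\<And>x. x \<in> ?S - K \<Longrightarrow> u x = 0"
    using assms(7) by (auto simp: hyp_test_function_def hyp_space_def)
  have "Ck_on (Suc 0) u ?S" using assms(7) by (auto simp only: hyp_test_function_def hyp_space_def)
  then have diff: "\<And>x. x \<in> ?S \<Longrightarrow> u differentiable (at x)"
    and cont: "\<And>v. continuous_on ?S (\<lambda>x. frechet_derivative u (at x) v)" by auto
  define p where "p = (\<lambda>x. \<Sum>b\<in>Basis. frechet_derivative u (at x) b *\<^sub>R b)"
  have cp: "continuous_on ?S p" unfolding p_def by (intro continuous_intros cont)
  have du: "(u has_derivative (\<lambda>v. p x \<bullet> v)) (at x)" if "x \<in> ?S" for x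
  proof -
    have D: "(u has_derivative frechet_derivative u (at x)) (at x)"
      using diff[OF that] by (simp add: frechet_derivative_works)
    have "frechet_derivative u (at x) v = p x \<bullet> v" for v
    proof -
      have "frechet_derivative u (at x) v = frechet_derivative u (at x) (\<Sum>b\<in>Basis. (v \<bullet> b) *\<^sub>R b)"
        by (simp add: euclidean_representation)
      also have "\<dots> = (\<Sum>b\<in>Basis. (v \<bullet> b) * frechet_derivative u (at x) b)"
        using has_derivative_linear[OF D] by (simp add: linear_sum linear_scale)
      also have "\<dots> = p x \<bullet> v"
        unfolding p_def inner_sum_left by (simp add: inner_commute mult.commute)
      finally show ?thesis .
    qed
    then have "frechet_derivative u (at x) = (\<lambda>v. p x \<bullet> v)" by (intro ext)
    then show ?thesis using D by simp
  qed

  have "continuous_on ?S u"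
    using du by (meson continuous_on_eq_continuous_at has_derivative_continuous open_ball)
  then have mU: "(\<lambda>x. indicator ?S x *\<^sub>R u x) \<in> borel_measurable borel"
    by (intro borel_measurable_continuous_on_indicator) auto
  have mp: "(\<lambda>x. indicator ?S x *\<^sub>R p x) \<in> borel_measurable borel"
    using cp by (intro borel_measurable_continuous_on_indicator) auto
  \<comment> \<open>The values of \<open>u\<close> outside the ball are arbitrary, perhaps not measurable.\<close>
  define U where "U = (\<lambda>x. indicator ?S x *\<^sub>R u x)"
  note [measurable] = mU[folded U_def] mp
  have Uu: "U x = u x" if "norm x < 1" for x using that by (simp add: U_def)
  have m\<rho> [measurable]: "\<rho> k \<in> borel_measurable borel" for k unfolding \<rho>_def by measurable

  define A B where "A = (real ?N - 2)\<^sup>2 / 4" "B = (real ?N - 2) * (real ?N - 3) / 2"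
  have AB: "A \<ge> 0" "B \<ge> 0" using N3 by (auto simp: A_B_def)
  define a where "a = (\<lambda>k x. if norm x < 1 then ennreal (conf_factor x ^ ?N) * ennreal ((U x)\<^sup>2 / (\<rho> k x)\<^sup>2) else 0)"
  define b where "b = (\<lambda>k x. if norm x < 1 then ennreal (conf_factor x ^ ?N) * ennreal (hardy_g (\<rho> k x) * (U x)\<^sup>2) else 0)"
  have mab [measurable]: "a k \<in> borel_measurable lborel" "b k \<in> borel_measurable lborel" for k
    unfolding a_def b_def by measurable
  have ia: "(\<integral>\<^sup>+x. ennreal ((u x)\<^sup>2 / (hyp_dist x (y k))\<^sup>2) \<partial>hyp_vol) = (\<integral>\<^sup>+x. a k x \<partial>lborel)" if "k \<in> ?I" for k
    unfolding a_def by (rule nn_integral_hyp_vol) (use \<rho> that Uu in auto)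
  have ib: "(\<integral>\<^sup>+x. ennreal (hardy_g (hyp_dist x (y k)) * (u x)\<^sup>2) \<partial>hyp_vol) = (\<integral>\<^sup>+x. b k x \<partial>lborel)" if "k \<in> ?I" for k
    unfolding b_def by (rule nn_integral_hyp_vol) (use \<rho> that Uu in auto)
  have "ennreal A * (\<Sum>k=1..M. \<integral>\<^sup>+x. ennreal ((u x)\<^sup>2 / (hyp_dist x (y k))\<^sup>2) \<partial>hyp_vol)
      + ennreal B * (\<Sum>k=1..M. \<integral>\<^sup>+x. ennreal (hardy_g (hyp_dist x (y k)) * (u x)\<^sup>2) \<partial>hyp_vol)
    = (\<integral>\<^sup>+x. (ennreal A * (\<Sum>k\<in>?I. a k x) + ennreal B * (\<Sum>k\<in>?I. b k x)) \<partial>lborel)"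
    by (simp add: ia ib nn_integral_add nn_integral_cmult nn_integral_sum)
  also have "\<dots> = (\<integral>\<^sup>+x. (if x \<in> ?S then ennreal (conf_factor x ^ DIM(real ^ 'n) *
      (\<Sum>k\<in>?I. hardy_potential (real DIM(real ^ 'n)) (arcosh (cosh_dist (y k) x))) * (u x)\<^sup>2) else 0) \<partial>lborel)"
  proof (rule nn_integral_cong)
    fix x :: "real ^ 'n"
    show "ennreal A * (\<Sum>k\<in>?I. a k x) + ennreal B * (\<Sum>k\<in>?I. b k x) =
      (if x \<in> ?S then ennreal (conf_factor x ^ DIM(real ^ 'n) *
      (\<Sum>k\<in>?I. hardy_potential (real DIM(real ^ 'n)) (arcosh (cosh_dist (y k) x))) * (u x)\<^sup>2) else 0)"
    proof (cases "norm x < 1")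
      case True
      define Q where "Q = conf_factor x ^ ?N"
      have Q: "Q \<ge> 0" using conf_factor_pos[OF True] by (simp add: Q_def)
      have g: "hardy_g (\<rho> k x) \<ge> 0" if "k \<in> ?I" for k
      proof (cases "\<rho> k x = 0")
        case False
        then have "\<rho> k x > 0"
          using cosh_dist_ge_1[OF True y[OF that]] by (simp add: \<rho>_def less_le)
        then show ?thesis by (rule hardy_g_nonneg)
      qed (simp add: hardy_g_def)
      have 1: "(\<Sum>k\<in>?I. a k x) = ennreal (\<Sum>k\<in>?I. Q * ((u x)\<^sup>2 / (\<rho> k x)\<^sup>2))"
        using True Q by (simp add: a_def Uu Q_def[symmetric] ennreal_mult'[symmetric] sum_ennreal)
      have 2: "(\<Sum>k\<in>?I. b k x) = ennreal (\<Sum>k\<in>?I. Q * (hardy_g (\<rho> k x) * (u x)\<^sup>2))"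
      proof -
        have "(\<Sum>k\<in>?I. b k x) = (\<Sum>k\<in>?I. ennreal (Q * (hardy_g (\<rho> k x) * (u x)\<^sup>2)))"
          using True Q by (simp add: b_def Uu Q_def[symmetric] ennreal_mult'[symmetric])
        also have "\<dots> = ennreal (\<Sum>k\<in>?I. Q * (hardy_g (\<rho> k x) * (u x)\<^sup>2))"
          using Q g by (intro sum_ennreal mult_nonneg_nonneg) auto
        finally show ?thesis .
      qed
      have "ennreal A * (\<Sum>k\<in>?I. a k x) + ennreal B * (\<Sum>k\<in>?I. b k x)
         = ennreal (A * (\<Sum>k\<in>?I. Q * ((u x)\<^sup>2 / (\<rho> k x)\<^sup>2)) + B * (\<Sum>k\<in>?I. Q * (hardy_g (\<rho> k x) * (u x)\<^sup>2)))"
        unfolding 1 2 using AB Q g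
        by (subst ennreal_plus) (auto simp: ennreal_mult' intro!: mult_nonneg_nonneg sum_nonneg)
      also have "A * (\<Sum>k\<in>?I. Q * ((u x)\<^sup>2 / (\<rho> k x)\<^sup>2)) + B * (\<Sum>k\<in>?I. Q * (hardy_g (\<rho> k x) * (u x)\<^sup>2))
         = Q * (\<Sum>k\<in>?I. hardy_potential (real ?N) (\<rho> k x)) * (u x)\<^sup>2"
        unfolding sum_distrib_left sum_distrib_right sum.distrib[symmetric]
        by (intro sum.cong refl) (simp add: hardy_potential_def A_B_def algebra_simps)
      finally show ?thesis using True by (simp add: Q_def \<rho>_def)
    qed (simp add: a_def b_def)
  qed
  also have "\<dots> \<le> (\<integral>\<^sup>+x. (if x \<in> ?S then ennreal (conf_factor x ^ n * (p x \<bullet> p x)) else 0) \<partial>lborel)"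
  proof (rule multipolar_hardy[OF n(1,2) _ _ _ K du cp d(1) _ sep])
    show "finite ?I" "?I \<noteq> {}" using assms(2) by auto
    show "pi\<^sup>2 / d\<^sup>2 + (real (card ?I) + 1) * ((real DIM(real ^ 'n) - 2)\<^sup>2 / 4 * (1 / d\<^sup>2)
      + (real DIM(real ^ 'n) - 3) * (real DIM(real ^ 'n) - 2) / 2 * hardy_g (d / 2)) \<le> real DIM(real ^ 'n) - 2"
      using d(2) by simp
  qed (use y in auto)
  also have "\<dots> = (\<integral>\<^sup>+x. (if norm x < 1 then ennreal (conf_factor x ^ ?N) *
      ennreal ((indicator ?S x *\<^sub>R p x) \<bullet> (indicator ?S x *\<^sub>R p x) / (conf_factor x)\<^sup>2) else 0) \<partial>lborel)"
  proof (intro nn_integral_cong)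
    fix x :: "real ^ 'n"
    have "conf_factor x ^ n * (p x \<bullet> p x) = conf_factor x ^ ?N * (p x \<bullet> p x / (conf_factor x)\<^sup>2)" if "norm x < 1"
      using conf_factor_pos[OF that] by (simp add: n(3) power_add power2_eq_square)
    then show "(if x \<in> ?S then ennreal (conf_factor x ^ n * (p x \<bullet> p x)) else 0) =
      (if norm x < 1 then ennreal (conf_factor x ^ ?N) *
      ennreal ((indicator ?S x *\<^sub>R p x) \<bullet> (indicator ?S x *\<^sub>R p x) / (conf_factor x)\<^sup>2) else 0)"
      using conf_factor_pos[of x] by (auto simp: ennreal_mult'[symmetric])
  qed
  also have "\<dots> = (\<integral>\<^sup>+x. ennreal ((hyp_norm x (hyp_grad u x))\<^sup>2) \<partial>hyp_vol)"
  proof (rule nn_integral_hyp_vol[symmetric])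
    show "(\<lambda>x. ennreal ((indicator ?S x *\<^sub>R p x) \<bullet> (indicator ?S x *\<^sub>R p x) / (conf_factor x)\<^sup>2)) \<in> borel_measurable borel"
      by measurable
  qed (use du in \<open>auto simp: hyp_norm_hyp_grad_sq\<close>)
  finally show ?thesis unfolding A_B_def .
qed

end
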